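(* Let $\gamma$ be a real constant. For each index $k$ let $n_1=2^{m_1}$ and $n_2=2^{m_2}$ with non-negative integers $m_1=m_1(k)$, $m_2=m_2(k)$, and let $A_1=A_1^{(k)}$ and $A_2=A_2^{(k)}$ be adjacency matrices of undirected degree-regular graphs on $n_1$ and $n_2$ vertices respectively, of the same degree $d=d(k)$ (every vertex of either graph has degree $d$). Suppose that the continuous-time quantum walks on the families $(A_1^{(k)})_k$ and $(A_2^{(k)})_k$ can both be efficiently implemented. Then the continuous-time quantum walks on the family of interdependent networks with complete interconnections, i.e. the graphs on $n_1+n_2$ vertices with adjacency matrices $$\begin{pmatrix} A_1 & J_{n_1,n_2}\\ J_{n_2,n_1} & A_2\end{pmatrix},$$ where $J_{a,b}$ is the $a\times b$ matrix with all entries equal to $1$, can be efficiently implemented.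
   Context: The adjacency matrix $A$ of an undirected graph on vertices $v_1,\dots,v_n$ is the symmetric $n\times n$ matrix with $A_{jk}=1$ if $(v_j,v_k)$ is an edge and $0$ otherwise. The degree of a vertex is the number of undirected edges connected to it. The continuous-time quantum walk (CTQW) on a graph with adjacency matrix $A$ is the evolution $U(t)=\exp(-itH)$, $t\ge0$, on the Hilbert space $\mathbb{C}^n$ with orthonormal basis indexed by the vertices, where $H=\gamma A$ and $\gamma$ is a fixed real constant (the hopping rate). Efficient implementation: an encoding of $n$ vertices is an injective map from the vertices to the computational basis states of a $q$-qubit register (with $q=m$ if $n=2^m$); it identifies $\mathbb{C}^n$ with a subspace of the register space. A quantum circuit (possibly using additional ancilla qubits that start in and are returned to $|0\rangle$) implements a unitary on $\mathbb{C}^n$ if it acts exactly (error $\epsilon=0$) as that unitary on the encoded subspace. The CTQWs of a family of graphs with adjacency matrices $(A^{(k)})_k$ of sizes $n_k$ can be efficiently implemented if there are encodings and a polynomial $p$ such that for every $k$ and every $t\ge0$ the operator $\exp(-it\gamma A^{(k)})$ is implemented by a quantum circuit with at most $p(\log n_k)$ one- and two-qubit gates (arbitrary unitary gates, whose parameters may depend on $t$, while the encoding does not); in particular the bound on the number of gates does not depend on $t$. *)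

theory Defs
  imports
    Complex_Main
    "HOL-Computational_Algebra.Polynomial"
    "Jordan_Normal_Form.Jordan_Normal_Form"
    "Jordan_Normal_Form.Schur_Decomposition"
begin

section \<open>Graphs\<close>

text \<open>The vertices are \<open>0, \<dots>, n - 1\<close>. An edge is an unordered pair of vertices; a loop at
  \<open>v\<close> is the singleton \<open>{v}\<close>. Loops are not excluded, and a loop counts as one edge in the degree.\<close>

definition undirected_graph :: "nat \<Rightarrow> nat set set \<Rightarrow> bool" where
  "undirected_graph n E \<longleftrightarrow> (\<forall>e\<in>E. \<exists>u<n. \<exists>v<n. e = {u, v})"

definition vertex_degree :: "nat set set \<Rightarrow> nat \<Rightarrow> nat" where
  "vertex_degree E v = card {e \<in> E. v \<in> e}"

definition degree_regular :: "nat \<Rightarrow> nat set set \<Rightarrow> nat \<Rightarrow> bool" where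
  "degree_regular n E d \<longleftrightarrow> (\<forall>v<n. vertex_degree E v = d)"

definition adjacency_mat :: "nat \<Rightarrow> nat set set \<Rightarrow> complex mat" where
  "adjacency_mat n E = mat n n (\<lambda>(j, k). if {j, k} \<in> E then 1 else 0)"

definition all_ones_mat :: "nat \<Rightarrow> nat \<Rightarrow> complex mat" where
  "all_ones_mat a b = mat a b (\<lambda>_. 1)"

definition complete_interconnection :: "complex mat \<Rightarrow> complex mat \<Rightarrow> complex mat" where
  "complete_interconnection A\<^sub>1 A\<^sub>2 =
     four_block_mat A\<^sub>1 (all_ones_mat (dim_row A\<^sub>1) (dim_row A\<^sub>2))
                    (all_ones_mat (dim_row A\<^sub>2) (dim_row A\<^sub>1)) A\<^sub>2"


section \<open>Continuous-time quantum walks\<close>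

definition mat_exp :: "complex mat \<Rightarrow> complex mat" where
  "mat_exp A = mat (dim_row A) (dim_row A) (\<lambda>ij. \<Sum>k. (A ^\<^sub>m k) $$ ij / fact k)"

text \<open>The series defining the entries converges absolutely.\<close>

lemma summable_mat_exp:
  fixes A :: "complex mat"
  assumes A: "A \<in> carrier_mat n n" and i: "i < n" and j: "j < n"
  shows "summable (\<lambda>k. norm ((A ^\<^sub>m k) $$ (i, j) / fact k))"
proof -
  obtain b where b: "norm_bound A b" using norm_bound_max by blast
  have pow: "norm_bound (A ^\<^sub>m k) ((b * of_nat n) ^ k)" for k
  proof (induction k)
    case 0
    show ?case using A by (auto simp: norm_bound_def)
  next
    case (Suc k)
    have "norm_bound (A ^\<^sub>m k * A) ((b * of_nat n) ^ k * b * of_nat n)"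
      by (rule norm_bound_mult[OF pow_carrier_mat[OF A] A Suc.IH b])
    then show ?case by (simp add: mult_ac)
  qed
  have le: "norm ((A ^\<^sub>m k) $$ (i, j) / fact k) \<le> (b * of_nat n) ^ k /\<^sub>R fact k" for k
  proof -
    have "norm ((A ^\<^sub>m k) $$ (i, j)) \<le> (b * of_nat n) ^ k"
      using pow[of k] A i j by (auto simp: norm_bound_def)
    then show ?thesis
      by (simp add: norm_divide divide_simps)
  qed
  show ?thesis
    by (rule summable_comparison_test'[OF summable_exp_generic[of "b * of_nat n"], of 0])
       (use le in simp)
qed

definition ctqw :: "real \<Rightarrow> complex mat \<Rightarrow> real \<Rightarrow> complex mat" where
  "ctqw \<gamma> A t = mat_exp ((- \<i> * of_real t) \<cdot>\<^sub>m (of_real \<gamma> \<cdot>\<^sub>m A))"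


section \<open>Quantum circuits\<close>

text \<open>The computational basis state \<open>|x\<^sub>N\<^sub>-\<^sub>1 \<dots> x\<^sub>1 x\<^sub>0\<rangle>\<close> of an \<open>N\<close>-qubit register is the unit vector
  whose index has the binary digits \<open>x\<^sub>l\<close>; qubit \<open>l\<close> is the digit of weight \<open>2 ^ l\<close>.
  \<open>Gate U qs\<close> applies \<open>U\<close> to the qubits \<open>qs\<close>, the head of \<open>qs\<close> being
  the least significant digit of the index into \<open>U\<close>.\<close>

datatype qgate = Gate (gate_op: "complex mat") (gate_qubits: "nat list")

definition unitary_mat :: "nat \<Rightarrow> complex mat \<Rightarrow> bool" where
  "unitary_mat n U \<longleftrightarrow> U \<in> carrier_mat n n \<and> mat_adjoint U * U = 1\<^sub>m n"

definition valid_gate :: "nat \<Rightarrow> qgate \<Rightarrow> bool" where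
  "valid_gate N g \<longleftrightarrow>
     length (gate_qubits g) \<in> {1, 2} \<and> distinct (gate_qubits g) \<and> set (gate_qubits g) \<subseteq> {..<N} \<and>
     unitary_mat (2 ^ length (gate_qubits g)) (gate_op g)"

definition local_index :: "nat list \<Rightarrow> nat \<Rightarrow> nat" where
  "local_index qs x = horner_sum of_bool 2 (map (bit x) qs)"

text \<open>\<open>U\<close> on the qubits \<open>qs\<close>, tensored with the identity on the other qubits.\<close>

definition gate_mat :: "nat \<Rightarrow> qgate \<Rightarrow> complex mat" where
  "gate_mat N g = mat (2 ^ N) (2 ^ N) (\<lambda>(x, y).
     if \<forall>l<N. l \<notin> set (gate_qubits g) \<longrightarrow> (bit x l \<longleftrightarrow> bit y l)
     then gate_op g $$ (local_index (gate_qubits g) x, local_index (gate_qubits g) y)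
     else 0)"

text \<open>The head of the list is the gate that is applied first.\<close>

primrec circuit_mat :: "nat \<Rightarrow> qgate list \<Rightarrow> complex mat" where
  "circuit_mat N [] = 1\<^sub>m (2 ^ N)"
| "circuit_mat N (g # gs) = circuit_mat N gs * gate_mat N g"


section \<open>Efficient implementation\<close>

definition encoding :: "nat \<Rightarrow> nat \<Rightarrow> (nat \<Rightarrow> nat) \<Rightarrow> bool" where
  "encoding n q enc \<longleftrightarrow>
     inj_on enc {..<n} \<and> enc ` {..<n} \<subseteq> {..<2 ^ q} \<and> (\<forall>m. n = 2 ^ m \<longrightarrow> q = m)"

text \<open>The state \<open>\<Sum>j<n. \<psi>\<^sub>j |enc j\<rangle>\<close> of an \<open>N\<close>-qubit register, where \<open>n\<close> is the dimension of
  \<open>\<psi>\<close>. If \<open>enc\<close> takes values below \<open>2 ^ q\<close> and \<open>q \<le> N\<close>, then the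
  qubits \<open>q, \<dots>, N - 1\<close> are all in state \<open>|0\<rangle>\<close>; they serve as ancillas.\<close>

definition encode_vec :: "nat \<Rightarrow> (nat \<Rightarrow> nat) \<Rightarrow> complex vec \<Rightarrow> complex vec" where
  "encode_vec N enc \<psi> = vec (2 ^ N) (\<lambda>x. \<Sum>j | j < dim_vec \<psi> \<and> enc j = x. \<psi> $ j)"

definition implements ::
  "nat \<Rightarrow> (nat \<Rightarrow> nat) \<Rightarrow> nat \<Rightarrow> qgate list \<Rightarrow> complex mat \<Rightarrow> bool" where
  "implements q enc a gs V \<longleftrightarrow>
     (\<forall>g\<in>set gs. valid_gate (q + a) g) \<and>
     (\<forall>\<psi>\<in>carrier_vec (dim_col V).
        circuit_mat (q + a) gs *\<^sub>v encode_vec (q + a) enc \<psi> = encode_vec (q + a) enc (V *\<^sub>v \<psi>))"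

text \<open>The base of the logarithm is immaterial, since the polynomial is arbitrary.\<close>

definition efficiently_implementable_ctqws :: "real \<Rightarrow> ('k \<Rightarrow> complex mat) \<Rightarrow> bool" where
  "efficiently_implementable_ctqws \<gamma> A \<longleftrightarrow>
     (\<exists>(q :: 'k \<Rightarrow> nat) (enc :: 'k \<Rightarrow> nat \<Rightarrow> nat) (p :: real poly).
        (\<forall>k. encoding (dim_row (A k)) (q k) (enc k)) \<and>
        (\<forall>k. \<forall>t\<ge>0. \<exists>a gs. implements (q k) (enc k) a gs (ctqw \<gamma> (A k) t) \<and>
           real (length gs) \<le> poly p (log 2 (real (dim_row (A k))))))"

end

(*
  On the span of the two uniform vectors, the adjacency matrix A\<oplus>B of the disjoint union acts as
  the scalar d, so it commutes with the interconnection part, whose exponential is a rotation by the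
  angle t \<gamma> sqrt (n1 n2) in the plane of the normalised uniform vectors and the identity on the
  orthogonal complement.

  To implement this, a flag qubit tells the two graphs apart and each graph gets a register of its
  own. The idle register is put into the state |0...0>; then Hadamard gates turn "active register
  uniform" into "both registers zero", and the plane rotation becomes a rotation of the flag
  controlled by all register qubits. No controlled version of the given circuits is needed: the idle
  register is put into the uniform state, which is an eigenvector of its walk, so that both
  circuits are run unconditionally and the idle one contributes the same phase exp (-i t \<gamma> d)
  in either case.
*)

theory Submission
  imports Defs
begin

section \<open>Registers as functions on bit configurations\<close>

text \<open>Nothing is known about the given encodings, yet the uniform vector has to be prepared.
  For n = 2 ^ m the register has exactly m data qubits, so an encoding is a bijection onto the basis
  states, and the uniform vector becomes the Hadamard image of |0...0> whichever bijection it is.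
  The given circuits are specified only on encoded states with all ancillas |0>. An idle register
  must therefore hold an encoded state whose evolution is known from regularity alone. The phase it
  contributes is cancelled by a scalar gate on the flag. Gates are counted, but ancillas are not:
  their number may vary with the index and with t. States are therefore amplitudes over the
  configurations of countably many qubits. Two registers with unlimited ancillas then fit side by
  side, and a finite register is chosen only at the end. Time enters through gate parameters alone,
  so the overhead in gates is linear in the number of data qubits for all t.\<close>

type_synonym qstate = "(nat \<Rightarrow> bool) \<Rightarrow> complex"

definition config_index :: "nat list \<Rightarrow> (nat \<Rightarrow> bool) \<Rightarrow> nat" where
  "config_index qs c = horner_sum of_bool 2 (map c qs)"

text \<open>The matrix-vector product restricted to the configurations that can contribute. A gate
  has finitely many qubits, so the sum is finite although there are infinitely many
  configurations.\<close>

definition act :: "qgate \<Rightarrow> qstate \<Rightarrow> qstate" where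
  "act g \<Psi> c = (\<Sum>c' | \<forall>l. l \<notin> set (gate_qubits g) \<longrightarrow> c' l = c l.
     gate_op g $$ (config_index (gate_qubits g) c, config_index (gate_qubits g) c') * \<Psi> c')"

abbreviation run :: "qgate list \<Rightarrow> qstate \<Rightarrow> qstate" where
  "run \<equiv> fold act"

lemma bit_horner_sum_config:
  "bit (horner_sum of_bool 2 (map c [0..<N]) :: nat) l \<longleftrightarrow> l < N \<and> c l"
  by (auto simp: bit_horner_sum_bit_iff)

lemma ex_nat_bits:
  assumes "\<And>l. N \<le> l \<Longrightarrow> \<not> c l"
  obtains x :: nat where "x < 2 ^ N" "bit x = c"
proof
  let ?x = "horner_sum of_bool 2 (map c [0..<N]) :: nat"
  show "?x < 2 ^ N"
    using horner_sum_of_bool_2_less[of "map c [0..<N]"] by simp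
  show "bit ?x = c"
    using assms by (auto simp: bit_horner_sum_config fun_eq_iff intro: leI)
qed

lemma bit_above: "x < 2 ^ N \<Longrightarrow> N \<le> l \<Longrightarrow> \<not> bit (x :: nat) l"
  by (metis bit_take_bit_iff linorder_not_less take_bit_nat_eq_self)

lemma inj_bit: "inj (bit :: nat \<Rightarrow> nat \<Rightarrow> bool)"
  by (auto intro!: injI simp: bit_eq_iff)

lemma gate_mat_act:
  assumes v: "v \<in> carrier_vec (2 ^ N)" and qs: "set (gate_qubits g) \<subseteq> {..<N}"
    and eq: "\<And>x. x < 2 ^ N \<Longrightarrow> v $ x = \<Psi> (bit x)" and x: "x < 2 ^ N"
  shows "(gate_mat N g *\<^sub>v v) $ x = act g \<Psi> (bit x)"
proof -
  let ?q = "gate_qubits g"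
  let ?B = "{y :: nat. y < 2 ^ N \<and> (\<forall>l<N. l \<notin> set ?q \<longrightarrow> (bit x l \<longleftrightarrow> bit y l))}"
  let ?C = "{c'. \<forall>l. l \<notin> set ?q \<longrightarrow> c' l = bit x l}"
  \<comment> \<open>All qubits of the gate and all set bits of \<open>x\<close> lie below
    \<open>N\<close>, so a configuration in \<open>?C\<close> is false from \<open>N\<close> on and
    comes from an index.\<close>
  have *: "bij_betw bit ?B ?C"
  proof (rule bij_betwI')
    fix y z :: nat
    show "(bit y = bit z) = (y = z)" by (metis inj_bit injD)
  next
    fix y assume y: "y \<in> ?B"
    show "bit y \<in> ?C"
    proof clarify
      fix l assume "l \<notin> set ?q"
      then show "bit y l = bit x l" using y bit_above[OF x, of l] bit_above[of y N l]
        by (cases "l < N") auto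
    qed
  next
    fix c' assume c': "c' \<in> ?C"
    have "\<not> c' l" if "N \<le> l" for l
      using c' qs bit_above[OF x that] that by force
    then obtain y :: nat where "y < 2 ^ N" "bit y = c'" using ex_nat_bits by metis
    then show "\<exists>y\<in>?B. c' = bit y" using c' by (intro bexI[of _ y]) auto
  qed
  have "(gate_mat N g *\<^sub>v v) $ x = (\<Sum>y = 0..<2 ^ N. gate_mat N g $$ (x, y) * v $ y)"
    using x v by (simp add: gate_mat_def scalar_prod_def)
  also have "\<dots> = (\<Sum>y\<in>?B. gate_op g $$ (local_index ?q x, local_index ?q y) * v $ y)"
    using x by (intro sum.mono_neutral_cong_right) (auto simp: gate_mat_def)
  also have "\<dots> = (\<Sum>y\<in>?B. gate_op g $$ (config_index ?q (bit x), config_index ?q (bit y)) * \<Psi> (bit y))"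
    by (rule sum.cong) (auto simp: local_index_def config_index_def eq)
  also have "\<dots> = (\<Sum>c'\<in>?C. gate_op g $$ (config_index ?q (bit x), config_index ?q c') * \<Psi> c')"
    by (rule sum.reindex_bij_betw[OF *])
  finally show ?thesis by (simp add: act_def)
qed

lemma gate_mat_carrier [simp]: "gate_mat N g \<in> carrier_mat (2 ^ N) (2 ^ N)"
  by (simp add: gate_mat_def)

lemma circuit_mat_carrier [simp]: "circuit_mat N gs \<in> carrier_mat (2 ^ N) (2 ^ N)"
  by (induction gs) (auto intro: mult_carrier_mat)

lemma circuit_mat_run:
  assumes "v \<in> carrier_vec (2 ^ N)" and "\<forall>g\<in>set gs. valid_gate N g"
    and "\<And>x. x < 2 ^ N \<Longrightarrow> v $ x = \<Psi> (bit x)" and "x < 2 ^ N"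
  shows "(circuit_mat N gs *\<^sub>v v) $ x = run gs \<Psi> (bit x)"
  using assms
proof (induction gs arbitrary: v \<Psi>)
  case (Cons g gs)
  have g: "set (gate_qubits g) \<subseteq> {..<N}" using Cons.prems(2) by (auto simp: valid_gate_def)
  have c: "gate_mat N g *\<^sub>v v \<in> carrier_vec (2 ^ N)"
    using Cons.prems(1) by (rule mult_mat_vec_carrier[OF gate_mat_carrier])
  have "circuit_mat N (g # gs) *\<^sub>v v = circuit_mat N gs *\<^sub>v (gate_mat N g *\<^sub>v v)"
    using Cons.prems(1) by (simp add: assoc_mult_mat_vec[of _ "2^N" "2^N" _ "2^N"])
  then show ?case
    using Cons.IH[OF c _ gate_mat_act[OF Cons.prems(1) g Cons.prems(3)]] Cons.prems(2,4) by simp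
qed simp

lemma act_cong:
  assumes "\<And>c'. (\<And>l. l \<notin> set (gate_qubits g) \<Longrightarrow> c' l = c l) \<Longrightarrow> \<Psi> c' = \<Phi> c'"
  shows "act g \<Psi> c = act g \<Phi> c"
  unfolding act_def by (rule sum.cong) (auto simp: assms)

text \<open>Locality: a gate connects only configurations that agree outside its own qubits, so
  qubits outside \<open>Q\<close> act as parameters. This serves to freeze a control and to show
  that amplitudes with a set qubit outside the register stay 0.\<close>

lemma run_cong:
  assumes "\<And>g. g \<in> set gs \<Longrightarrow> set (gate_qubits g) \<subseteq> Q"
    and "\<And>c'. (\<And>l. l \<notin> Q \<Longrightarrow> c' l = c l) \<Longrightarrow> \<Psi> c' = \<Phi> c'"
  shows "run gs \<Psi> c = run gs \<Phi> c"
  using assms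
proof (induction gs arbitrary: \<Psi> \<Phi>)
  case Nil then show ?case by simp
next
  case (Cons g gs)
  have "run gs (act g \<Psi>) c = run gs (act g \<Phi>) c"
  proof (rule Cons.IH)
    show "act g \<Psi> c' = act g \<Phi> c'" if "\<And>l. l \<notin> Q \<Longrightarrow> c' l = c l" for c'
      by (rule act_cong, rule Cons.prems(2)) (use that Cons.prems(1)[of g] in auto)
  qed (use Cons.prems(1) in auto)
  then show ?case by simp
qed

lemma act_zero [simp]: "act g (\<lambda>_. 0) = (\<lambda>_. 0)"
  by (simp add: act_def fun_eq_iff)

lemma run_zero [simp]: "run gs (\<lambda>_. 0) = (\<lambda>_. 0)"
  by (induction gs) auto

lemma act_linear: "act g (\<lambda>c. a * \<Psi> c + b * \<Phi> c) = (\<lambda>c. a * act g \<Psi> c + b * act g \<Phi> c)"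
  by (simp add: act_def fun_eq_iff sum_distrib_left sum.distrib algebra_simps)

lemma run_linear: "run gs (\<lambda>c. a * \<Psi> c + b * \<Phi> c) = (\<lambda>c. a * run gs \<Psi> c + b * run gs \<Phi> c)"
  by (induction gs arbitrary: \<Psi> \<Phi>) (simp_all add: act_linear)

lemma run_scale: "run gs (\<lambda>c. a * \<Psi> c) = (\<lambda>c. a * run gs \<Psi> c)"
  using run_linear[of gs a \<Psi> 0 "\<lambda>_. 0"] by simp

text \<open>\<open>bit\<close> of a natural number is false from some position on, so every ancilla
  is in state |0>, however many there are.\<close>

definition encoded :: "(nat \<Rightarrow> nat) \<Rightarrow> complex vec \<Rightarrow> qstate" where
  "encoded enc \<psi> c = (\<Sum>j | j < dim_vec \<psi> \<and> bit (enc j) = c. \<psi> $ j)"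

lemma encode_vec_encoded: "x < 2 ^ N \<Longrightarrow> encode_vec N enc \<psi> $ x = encoded enc \<psi> (bit x)"
  by (auto simp: encode_vec_def encoded_def inj_eq[OF inj_bit])

lemma encoded_eq_0:
  assumes "\<And>j. j < dim_vec \<psi> \<Longrightarrow> enc j < 2 ^ N" "N \<le> l" "c l"
  shows "encoded enc \<psi> c = 0"
proof -
  have "{j. j < dim_vec \<psi> \<and> bit (enc j) = c} = {}"
    using assms bit_above by blast
  then show ?thesis unfolding encoded_def by (metis sum.empty)
qed

text \<open>Where a qubit beyond the register is set, both sides of the equation vanish, so the
  identity on the finite register extends to all configurations. The number \<open>a\<close> of
  ancillas survives only in the validity of the gates.\<close>

lemma implements_iff_run:
  assumes V: "V \<in> carrier_mat n n" and enc: "\<And>j. j < n \<Longrightarrow> enc j < 2 ^ q"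
  shows "implements q enc a gs V \<longleftrightarrow>
     (\<forall>g\<in>set gs. valid_gate (q + a) g) \<and>
     (\<forall>\<psi>\<in>carrier_vec n. run gs (encoded enc \<psi>) = encoded enc (V *\<^sub>v \<psi>))"
proof -
  let ?N = "q + a"
  have enc': "enc j < 2 ^ ?N" if "j < n" for j
    using enc[OF that] by (rule less_le_trans) (simp add: power_add)
  have "(circuit_mat ?N gs *\<^sub>v encode_vec ?N enc \<psi> = encode_vec ?N enc (V *\<^sub>v \<psi>)) \<longleftrightarrow>
        run gs (encoded enc \<psi>) = encoded enc (V *\<^sub>v \<psi>)"
    if g: "\<forall>g\<in>set gs. valid_gate ?N g" and psi: "\<psi> \<in> carrier_vec n" for \<psi>
  proof -
    have Vpsi: "V *\<^sub>v \<psi> \<in> carrier_vec n" using V psi by simp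
    have ev: "encode_vec ?N enc \<phi> \<in> carrier_vec (2 ^ ?N)" for \<phi>
      by (simp add: encode_vec_def)
    have *: "(circuit_mat ?N gs *\<^sub>v encode_vec ?N enc \<psi>) $ x = run gs (encoded enc \<psi>) (bit x)"
      if "x < 2 ^ ?N" for x
      by (rule circuit_mat_run[OF ev g encode_vec_encoded that])
    have "(circuit_mat ?N gs *\<^sub>v encode_vec ?N enc \<psi> = encode_vec ?N enc (V *\<^sub>v \<psi>)) \<longleftrightarrow>
       (\<forall>x::nat. x < 2 ^ ?N \<longrightarrow> run gs (encoded enc \<psi>) (bit x) = encoded enc (V *\<^sub>v \<psi>) (bit x))"
      using carrier_vecD[OF mult_mat_vec_carrier[OF circuit_mat_carrier ev]] carrier_vecD[OF ev]
      by (subst vec_eq_iff) (auto simp: * encode_vec_encoded simp del: index_mult_mat_vec)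
    also have "\<dots> \<longleftrightarrow> run gs (encoded enc \<psi>) = encoded enc (V *\<^sub>v \<psi>)"
    proof
      assume eq: "\<forall>x::nat. x < 2 ^ ?N \<longrightarrow> run gs (encoded enc \<psi>) (bit x) = encoded enc (V *\<^sub>v \<psi>) (bit x)"
      show "run gs (encoded enc \<psi>) = encoded enc (V *\<^sub>v \<psi>)"
      proof
        fix c
        show "run gs (encoded enc \<psi>) c = encoded enc (V *\<^sub>v \<psi>) c"
        proof (cases "\<exists>l\<ge>?N. c l")
          case False
          then obtain x :: nat where "x < 2 ^ ?N" "bit x = c" using ex_nat_bits by metis
          then show ?thesis using eq by auto
        next
          case True
          then obtain l where l: "l \<ge> ?N" "c l" by blast
          have z: "encoded enc \<phi> c' = 0" if "c' l" "\<phi> \<in> carrier_vec n" for c' \<phi>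
            by (rule encoded_eq_0[of \<phi> enc ?N l]) (use that l enc' in auto)
          have "run gs (encoded enc \<psi>) c = run gs (\<lambda>_. 0) c"
          proof (rule run_cong[where Q = "{..<?N}"])
            show "set (gate_qubits g) \<subseteq> {..<?N}" if "g \<in> set gs" for g
              using that \<open>\<forall>g\<in>set gs. valid_gate ?N g\<close> by (auto simp: valid_gate_def)
            show "encoded enc \<psi> c' = 0" if "\<And>l. l \<notin> {..<?N} \<Longrightarrow> c' l = c l" for c'
              by (rule z) (use that[of l] l psi in auto)
          qed
          then show ?thesis using z[of c, OF _ Vpsi] l(2) by simp
        qed
      qed
    qed simp
    finally show ?thesis .
  qed
  then show ?thesis using V by (auto simp: implements_def)
qed

lemma valid_gate_mono: "valid_gate N g \<Longrightarrow> N \<le> N' \<Longrightarrow> valid_gate N' g"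
  by (force simp: valid_gate_def)

text \<open>Leaves the register size open: a circuit is assembled first, and a register containing
  its finitely many qubits is chosen afterwards.\<close>

definition wf_gate :: "qgate \<Rightarrow> bool" where
  "wf_gate g \<longleftrightarrow> (\<exists>N. valid_gate N g)"

lemma wf_gate_iff:
  "wf_gate g \<longleftrightarrow> length (gate_qubits g) \<in> {1, 2} \<and> distinct (gate_qubits g) \<and>
     unitary_mat (2 ^ length (gate_qubits g)) (gate_op g)"
proof -
  have "\<exists>N. set (gate_qubits g) \<subseteq> {..<N}"
    by (metis List.finite_set finite_nat_iff_bounded)
  then show ?thesis by (auto simp: wf_gate_def valid_gate_def)
qed

lemma wf_gates_bound:
  assumes "\<forall>g\<in>set gs. wf_gate g"
  shows "\<exists>a. \<forall>g\<in>set gs. valid_gate (q + a) g"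
  using assms
proof (induction gs)
  case (Cons g gs)
  then obtain a N where "\<forall>g\<in>set gs. valid_gate (q + a) g" "valid_gate N g"
    by (auto simp: wf_gate_def)
  then have "\<forall>g\<in>set (g # gs). valid_gate (q + (a + N)) g"
    by (auto elim!: valid_gate_mono)
  then show ?case by blast
qed simp

section \<open>One- and two-qubit gates\<close>

definition act1 :: "complex mat \<Rightarrow> nat \<Rightarrow> qstate \<Rightarrow> qstate" where
  "act1 U q \<Psi> c = U $$ (of_bool (c q), 0) * \<Psi> (c(q := False)) + U $$ (of_bool (c q), 1) * \<Psi> (c(q := True))"

lemma act_Gate1: "act (Gate U [q]) = act1 U q"
proof (intro ext)
  fix \<Psi> and c :: "nat \<Rightarrow> bool"
  have *: "{c'. \<forall>l. l \<notin> set [q] \<longrightarrow> c' l = c l} = {c(q := False), c(q := True)}"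
  proof (intro equalityI subsetI)
    fix c' assume c': "c' \<in> {c'. \<forall>l. l \<notin> set [q] \<longrightarrow> c' l = c l}"
    then have "c' = c(q := c' q)" by (auto simp: fun_eq_iff)
    then show "c' \<in> {c(q := False), c(q := True)}" by (cases "c' q") auto
  qed auto
  have "c(q := False) \<noteq> c(q := True)" by (metis fun_upd_same)
  then show "act (Gate U [q]) \<Psi> c = act1 U q \<Psi> c"
    by (simp add: act_def act1_def * [simplified] config_index_def)
qed

definition mat2 :: "complex \<Rightarrow> complex \<Rightarrow> complex \<Rightarrow> complex \<Rightarrow> complex mat" where
  "mat2 a b c d = mat 2 2 (\<lambda>(i, j). if i = 0 then (if j = 0 then a else b) else (if j = 0 then c else d))"

lemma mat2_carrier [simp]: "mat2 a b c d \<in> carrier_mat 2 2"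
  by (simp add: mat2_def)

lemma mat2_index [simp]:
  "mat2 a b c d $$ (0, 0) = a" "mat2 a b c d $$ (0, Suc 0) = b"
  "mat2 a b c d $$ (Suc 0, 0) = c" "mat2 a b c d $$ (Suc 0, Suc 0) = d"
  by (simp_all add: mat2_def)

lemma unitary_mat2_iff:
  assumes U: "U \<in> carrier_mat 2 2"
  shows "unitary_mat 2 U \<longleftrightarrow>
    cnj (U $$ (0, 0)) * U $$ (0, 0) + cnj (U $$ (1, 0)) * U $$ (1, 0) = 1 \<and>
    cnj (U $$ (0, 0)) * U $$ (0, 1) + cnj (U $$ (1, 0)) * U $$ (1, 1) = 0 \<and>
    cnj (U $$ (0, 1)) * U $$ (0, 0) + cnj (U $$ (1, 1)) * U $$ (1, 0) = 0 \<and>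
    cnj (U $$ (0, 1)) * U $$ (0, 1) + cnj (U $$ (1, 1)) * U $$ (1, 1) = 1"
proof -
  have less2: "(\<forall>i<2. P i) \<longleftrightarrow> P 0 \<and> P (Suc 0)" for P :: "nat \<Rightarrow> bool"
    by (auto simp: less_2_cases_iff)
  have entry: "(mat_adjoint U * U) $$ (i, j) = cnj (U $$ (0, i)) * U $$ (0, j) + cnj (U $$ (1, i)) * U $$ (1, j)"
    if "i < 2" "j < 2" for i j
    using U that by (simp add: mat_adjoint_def mat_of_rows_def scalar_prod_def numeral_2_eq_2)
  have "mat_adjoint U * U = 1\<^sub>m 2 \<longleftrightarrow> (\<forall>i<2. \<forall>j<2. (mat_adjoint U * U) $$ (i, j) = 1\<^sub>m 2 $$ (i, j))"
    using U by (auto simp: mat_eq_iff mat_adjoint_def mat_of_rows_def simp del: index_mult_mat(1))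
  then show ?thesis
    using U by (simp add: unitary_mat_def entry less2 del: index_mult_mat(1))
qed

lemma act1_act1:
  assumes "U \<in> carrier_mat 2 2" "W \<in> carrier_mat 2 2"
  shows "act1 U q (act1 W q \<Psi>) = act1 (U * W) q \<Psi>"
  using assms by (auto simp: act1_def fun_eq_iff scalar_prod_def numeral_2_eq_2 algebra_simps)

lemma act1_one: "act1 (1\<^sub>m 2) q \<Psi> = \<Psi>"
proof
  fix c :: "nat \<Rightarrow> bool"
  have "c(q := c q) = c" by simp
  then show "act1 (1\<^sub>m 2) q \<Psi> c = \<Psi> c" by (cases "c q") (simp_all add: act1_def del: fun_upd_triv)
qed

lemma act1_commute:
  assumes "p \<noteq> q"
  shows "act1 U p (act1 W q \<Psi>) = act1 W q (act1 U p \<Psi>)"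
  using assms by (simp add: act1_def fun_eq_iff fun_upd_twist[of p q] algebra_simps)

text \<open>The control is the head of the qubit list and hence the least significant digit: the
  parity of an index is the control, its half is the target. \<open>U\<close> fires when the control
  equals \<open>s\<close>.\<close>

definition ctrl_mat :: "bool \<Rightarrow> complex mat \<Rightarrow> complex mat" where
  "ctrl_mat s U = mat 4 4 (\<lambda>(i, j). if (odd i \<longleftrightarrow> odd j)
     then (if odd i = s then U $$ (i div 2, j div 2) else of_bool (i = j)) else 0)"

definition cgate :: "bool \<Rightarrow> complex mat \<Rightarrow> nat \<Rightarrow> nat \<Rightarrow> qgate" where
  "cgate s U p q = Gate (ctrl_mat s U) [p, q]"

lemma act_cgate:
  assumes "p \<noteq> q"
  shows "act (cgate s U p q) \<Psi> c = (if c p = s then act1 U q \<Psi> c else \<Psi> c)"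
proof -
  let ?f = "\<lambda>(a :: bool, b :: bool). c(p := a, q := b)"
  have inj: "inj ?f"
    using assms by (auto intro!: injI dest: fun_cong[of _ _ p] fun_cong[of _ _ q])
  have *: "{c'. \<forall>l. l \<notin> set [p, q] \<longrightarrow> c' l = c l} = ?f ` UNIV"
  proof (intro equalityI subsetI)
    fix c' assume "c' \<in> {c'. \<forall>l. l \<notin> set [p, q] \<longrightarrow> c' l = c l}"
    then have "c' = ?f (c' p, c' q)" by (auto simp: fun_eq_iff)
    then show "c' \<in> ?f ` UNIV" by blast
  qed (auto simp: assms)
  have UNIV: "(UNIV :: (bool \<times> bool) set) = {(False, False), (False, True), (True, False), (True, True)}"
    by auto
  have "act (cgate s U p q) \<Psi> c = (\<Sum>ab\<in>UNIV. ctrl_mat s U $$ (config_index [p, q] c, config_index [p, q] (?f ab)) * \<Psi> (?f ab))"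
    unfolding act_def cgate_def qgate.sel * by (subst sum.reindex) (use inj in auto)
  also have "\<dots> = (if c p = s then act1 U q \<Psi> c else \<Psi> c)"
    unfolding UNIV
    using assms fun_upd_triv[of c p] fun_upd_triv[of c q]
    by (cases "c p"; cases "c q"; cases s)
       (simp_all add: act1_def config_index_def ctrl_mat_def fun_upd_idem)
  finally show ?thesis .
qed

lemma unitary_ctrl_mat:
  assumes "unitary_mat 2 U"
  shows "unitary_mat 4 (ctrl_mat s U)"
proof -
  have U: "U \<in> carrier_mat 2 2" using assms by (simp add: unitary_mat_def)
  note eqs = assms[unfolded unitary_mat2_iff[OF U]]
  have C: "ctrl_mat s U \<in> carrier_mat 4 4" by (simp add: ctrl_mat_def)
  have entry: "(mat_adjoint (ctrl_mat s U) * ctrl_mat s U) $$ (i, j) = (\<Sum>l\<in>{0,1,2,3}. cnj (ctrl_mat s U $$ (l, i)) * ctrl_mat s U $$ (l, j))"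
    if "i < 4" "j < 4" for i j
    using C that by (simp add: mat_adjoint_def mat_of_rows_def scalar_prod_def numeral_eq_Suc)
  have "mat_adjoint (ctrl_mat s U) * ctrl_mat s U = 1\<^sub>m 4"
  proof (rule eq_matI)
    fix i j assume "i < dim_row (1\<^sub>m 4 :: complex mat)" "j < dim_col (1\<^sub>m 4 :: complex mat)"
    then have ij: "i < 4" "j < 4" by auto
    then have "i \<in> {0, 1, 2, 3}" "j \<in> {0, 1, 2, 3}" by auto
    then show "(mat_adjoint (ctrl_mat s U) * ctrl_mat s U) $$ (i, j) = 1\<^sub>m 4 $$ (i, j)"
      unfolding entry[OF ij] using eqs
      by (cases s) (auto simp: ctrl_mat_def)
  qed (use C in \<open>auto simp: mat_adjoint_def mat_of_rows_def\<close>)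
  then show ?thesis using C by (simp add: unitary_mat_def)
qed

lemma wf_Gate1: "unitary_mat 2 U \<Longrightarrow> wf_gate (Gate U [q])"
  by (simp add: wf_gate_iff)

lemma wf_cgate: "unitary_mat 2 U \<Longrightarrow> p \<noteq> q \<Longrightarrow> wf_gate (cgate s U p q)"
  using unitary_ctrl_mat[of U s] by (simp add: wf_gate_iff cgate_def power2_eq_square)

definition pauli_x :: "complex mat" where "pauli_x = mat2 0 1 1 0"
definition sqrt_x :: "complex mat" where
  "sqrt_x = mat2 ((1 + \<i>) / 2) ((1 - \<i>) / 2) ((1 - \<i>) / 2) ((1 + \<i>) / 2)"
definition sqrt_x_adj :: "complex mat" where
  "sqrt_x_adj = mat2 ((1 - \<i>) / 2) ((1 + \<i>) / 2) ((1 + \<i>) / 2) ((1 - \<i>) / 2)"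
definition hadamard :: "complex mat" where
  "hadamard = mat2 (1 / sqrt 2) (1 / sqrt 2) (1 / sqrt 2) (- 1 / sqrt 2)"

lemma unitary_gates [simp]:
  "unitary_mat 2 pauli_x" "unitary_mat 2 sqrt_x" "unitary_mat 2 sqrt_x_adj" "unitary_mat 2 hadamard"
  by (auto simp: unitary_mat2_iff pauli_x_def sqrt_x_def sqrt_x_adj_def hadamard_def
      complex_eq_iff field_simps simp flip: of_real_mult)

lemma act1_pauli_x: "act1 pauli_x q \<Psi> c = \<Psi> (c(q := \<not> c q))"
  by (simp add: act1_def pauli_x_def)

text \<open>The five-gate decomposition with V = \<open>sqrt_x\<close>. Writing a, b for the truth
  values of the two controls, V is applied to the target with exponent b - (a xor b) + a, which is 2
  if both hold and 0 otherwise; V squared is the NOT gate.\<close>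

definition toffoli :: "bool \<Rightarrow> nat \<Rightarrow> bool \<Rightarrow> nat \<Rightarrow> nat \<Rightarrow> qgate list" where
  "toffoli sa a sb b t = [cgate sb sqrt_x b t, cgate sa pauli_x a b, cgate sb sqrt_x_adj b t,
     cgate sa pauli_x a b, cgate sa sqrt_x a t]"

lemma mult_mat2:
  "mat2 a b c d * mat2 a' b' c' d' = mat2 (a * a' + b * c') (a * b' + b * d') (c * a' + d * c') (c * b' + d * d')"
  by (rule eq_matI) (auto simp: mat2_def scalar_prod_def numeral_2_eq_2 less_Suc_eq)

lemma one_mat2: "1\<^sub>m 2 = mat2 1 0 0 1"
  by (rule eq_matI) (auto simp: mat2_def numeral_2_eq_2 less_Suc_eq)

lemma hadamard_mult: "hadamard * hadamard = 1\<^sub>m 2"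
  by (simp add: hadamard_def one_mat2 mult_mat2 complex_eq_iff field_simps flip: of_real_mult)

lemma run_toffoli:
  assumes "a \<noteq> b" "a \<noteq> t" "b \<noteq> t"
  shows "run (toffoli sa a sb b t) \<Psi> c = \<Psi> (if c a = sa \<and> c b = sb then c(t := \<not> c t) else c)"
proof -
  have tb: "(c :: nat \<Rightarrow> bool)(t := x, b := y) = c(b := y, t := x)" for c x y
    using assms by (simp add: fun_upd_twist)
  have id: "c(t := False) = c" if "\<not> c t" using that by (simp add: fun_upd_idem)
  have id': "c(t := True) = c" if "c t" using that by (simp add: fun_upd_idem)
  show ?thesis
    using assms
    by (cases "c a = sa"; cases "c b = sb"; cases "c t")
       (simp_all add: toffoli_def act_cgate act1_pauli_x act1_def[of sqrt_x] act1_def[of sqrt_x_adj]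
          tb id id', simp_all add: sqrt_x_def sqrt_x_adj_def field_simps complex_eq_iff fun_upd_idem)
qed

lemma wf_toffoli:
  assumes "a \<noteq> b" "a \<noteq> t" "b \<noteq> t" "g \<in> set (toffoli sa a sb b t)"
  shows "wf_gate g"
  using assms by (auto simp: toffoli_def intro: wf_cgate)

lemma length_toffoli [simp]: "length (toffoli sa a sb b t) = 5"
  by (simp add: toffoli_def)

section \<open>Relocated, controlled and Hadamard circuits\<close>

definition relocate :: "(nat \<Rightarrow> nat) \<Rightarrow> qgate \<Rightarrow> qgate" where
  "relocate r g = Gate (gate_op g) (map r (gate_qubits g))"

definition plug :: "(nat \<Rightarrow> nat) \<Rightarrow> (nat \<Rightarrow> bool) \<Rightarrow> (nat \<Rightarrow> bool) \<Rightarrow> nat \<Rightarrow> bool" where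
  "plug r c z l = (if l \<in> range r then z (inv_into UNIV r l) else c l)"

lemma plug_comp: "inj r \<Longrightarrow> plug r c z \<circ> r = z"
  by (auto simp: plug_def fun_eq_iff)

lemma plug_plug: "plug r (plug r c z) z' = plug r c z'"
  by (auto simp: plug_def fun_eq_iff)

text \<open>With the qubits outside \<open>range r\<close> frozen at their values in
  \<open>c\<close>, what remains is a state of the original register, and the moved gate acts on
  this slice as before.\<close>

lemma act_relocate:
  assumes "inj r"
  shows "act (relocate r g) \<Psi> c = act g (\<lambda>z. \<Psi> (plug r c z)) (c \<circ> r)"
  unfolding act_def
proof (rule sum.reindex_bij_witness[of _ "plug r c" "\<lambda>c'. c' \<circ> r"])
  fix c' assume "c' \<in> {c'. \<forall>l. l \<notin> set (gate_qubits (relocate r g)) \<longrightarrow> c' l = c l}"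
  then have out: "c' l = c l" if "l \<notin> r ` set (gate_qubits g)" for l
    using that by (auto simp: relocate_def)
  show 1: "plug r c (c' \<circ> r) = c'"
    using out by (auto simp: plug_def fun_eq_iff f_inv_into_f)
  show "c' \<circ> r \<in> {z. \<forall>l. l \<notin> set (gate_qubits g) \<longrightarrow> z l = (c \<circ> r) l}"
    using out by (auto simp: inj_image_mem_iff[OF assms])
  show "gate_op g $$ (config_index (gate_qubits g) (c \<circ> r), config_index (gate_qubits g) (c' \<circ> r)) *
      \<Psi> (plug r c (c' \<circ> r)) =
    gate_op (relocate r g) $$ (config_index (gate_qubits (relocate r g)) c,
      config_index (gate_qubits (relocate r g)) c') * \<Psi> c'"
    unfolding 1 by (simp add: relocate_def config_index_def)
next
  fix z assume "z \<in> {z. \<forall>l. l \<notin> set (gate_qubits g) \<longrightarrow> z l = (c \<circ> r) l}"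
  then show "plug r c z \<in> {c'. \<forall>l. l \<notin> set (gate_qubits (relocate r g)) \<longrightarrow> c' l = c l}"
    by (auto simp: plug_def relocate_def f_inv_into_f) (metis assms inv_f_f rangeI image_eqI)+
qed (simp add: plug_comp assms)

lemma run_relocate:
  assumes "inj r"
  shows "run (map (relocate r) gs) \<Psi> c = run gs (\<lambda>z. \<Psi> (plug r c z)) (c \<circ> r)"
proof (induction gs arbitrary: \<Psi>)
  case Nil
  have "plug r c (c \<circ> r) = c" by (auto simp: plug_def fun_eq_iff f_inv_into_f)
  then show ?case by (simp del: o_apply add: fold_simps id_apply)
next
  case (Cons g gs)
  then show ?case by (simp add: act_relocate plug_plug plug_comp assms)
qed

lemma wf_relocate: "inj r \<Longrightarrow> wf_gate g \<Longrightarrow> wf_gate (relocate r g)"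
  by (simp add: wf_gate_iff relocate_def distinct_map inj_on_subset[of r UNIV])

lemma run_controlled:
  assumes "p \<notin> set qs"
  shows "run (map (cgate s U p) qs) \<Psi> c =
    (if c p = s then run (map (\<lambda>q. Gate U [q]) qs) \<Psi> c else \<Psi> c)"
  using assms
proof (induction qs arbitrary: \<Psi>)
  case (Cons q qs)
  \<comment> \<open>None of the later gates touches \<open>p\<close>, so by locality the control has
    its value in \<open>c\<close> at every configuration that matters.\<close>
  have "run (map (\<lambda>q. Gate U [q]) qs) (act (cgate s U p q) \<Psi>) c =
        run (map (\<lambda>q. Gate U [q]) qs) (act (Gate U [q]) \<Psi>) c" if "c p = s"
    by (rule run_cong[where Q = "set qs"]) (use Cons.prems that in \<open>auto simp: act_cgate act_Gate1\<close>)
  then show ?case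
    using Cons by (simp add: act_cgate)
qed simp

text \<open>Each qubit of \<open>ls\<close> costs one ancilla \<open>w\<close>, which records that all the controls so far
  are satisfied.\<close>

fun multi_ctrl :: "complex mat \<Rightarrow> nat \<Rightarrow> nat list \<Rightarrow> nat \<Rightarrow> nat \<Rightarrow> bool \<Rightarrow> qgate list" where
  "multi_ctrl U t [] w p s = [cgate s U p t]"
| "multi_ctrl U t (l # ls) w p s =
     toffoli s p False l w @ multi_ctrl U t ls (Suc w) w True @ toffoli s p False l w"

text \<open>Off the subspace where the ancillas are zero, it only matters that the circuit never mixes
  configurations that differ outside \<open>t\<close>; hence the unspecified predicate \<open>P\<close>.\<close>

lemma run_multi_ctrl:
  assumes "p < w" "t < w" "p \<noteq> t" "p \<notin> set ls" "t \<notin> set ls" "\<forall>l\<in>set ls. l < w"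
  shows "\<exists>P. (\<forall>\<Psi> c. run (multi_ctrl U t ls w p s) \<Psi> c = (if P c then act1 U t \<Psi> c else \<Psi> c)) \<and>
    (\<forall>c. (\<forall>j\<ge>w. \<not> c j) \<longrightarrow> P c = (c p = s \<and> (\<forall>l\<in>set ls. \<not> c l)))"
  using assms
proof (induction ls arbitrary: w p s)
  case Nil
  then show ?case
    by (intro exI[of _ "\<lambda>c. c p = s"]) (simp add: act_cgate)
next
  case (Cons l ls)
  define \<tau> where "\<tau> c = (if c p = s \<and> c l = False then c(w := \<not> c w) else c)" for c
  have neq: "p \<noteq> l" "p \<noteq> w" "l \<noteq> w" "t \<noteq> p" "t \<noteq> l" "t \<noteq> w" using Cons.prems by auto
  have tof: "run (toffoli s p False l w) \<Psi> = (\<lambda>c. \<Psi> (\<tau> c))" for \<Psi>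
    using neq by (simp add: run_toffoli \<tau>_def fun_eq_iff)
  have \<tau>\<tau>: "\<tau> (\<tau> c) = c" for c
    using neq by (auto simp: \<tau>_def)
  have \<tau>t: "(\<tau> c)(t := x) = \<tau> (c(t := x))" for c x
    using neq by (simp add: \<tau>_def fun_upd_twist)
  have "\<tau> c t = c t" for c using neq by (simp add: \<tau>_def)
  then have act1: "act1 U t (\<lambda>c. \<Psi> (\<tau> c)) (\<tau> c) = act1 U t \<Psi> c" for \<Psi> c
    by (simp add: act1_def \<tau>t \<tau>\<tau>)
  have ls: "w \<notin> set ls" "\<forall>l\<in>set ls. l < Suc w" "t \<notin> set ls"
    using Cons.prems by (auto simp: less_Suc_eq)
  obtain P where P: "\<And>\<Psi> c. run (multi_ctrl U t ls (Suc w) w True) \<Psi> c = (if P c then act1 U t \<Psi> c else \<Psi> c)"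
    and P': "\<And>c. (\<forall>j\<ge>Suc w. \<not> c j) \<Longrightarrow> P c = (c w = True \<and> (\<forall>l\<in>set ls. \<not> c l))"
    using Cons.IH[of w "Suc w" True, OF lessI less_SucI[OF Cons.prems(2)] neq(6)[symmetric] ls(1,3,2)]
    by blast
  \<comment> \<open>The induction hypothesis asks for zero ancillas only from \<open>Suc w\<close>
    on; \<open>\<tau>\<close> writes to \<open>w\<close> alone, and there it records the condition
    collected so far.\<close>
  have "P (\<tau> c) = (c p = s \<and> (\<forall>l\<in>set (l # ls). \<not> c l))" if c: "\<forall>j\<ge>w. \<not> c j" for c
  proof -
    have "\<forall>j\<ge>Suc w. \<not> \<tau> c j" using c by (auto simp: \<tau>_def)
    moreover have "\<not> c w" using c by auto
    moreover have "\<tau> c l' = c l'" if "l' \<in> set ls" for l'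
      using that Cons.prems by (auto simp: \<tau>_def)
    ultimately show ?thesis by (auto simp: P') (auto simp: \<tau>_def split: if_splits)
  qed
  then show ?case
    \<comment> \<open>Both outer Toffoli gates are the same involution \<open>\<tau>\<close>, which
      neither reads nor changes \<open>t\<close>. Conjugation by it leaves \<open>act1 U t\<close>
      as it is and moves \<open>\<tau>\<close> into the condition.\<close>
    by (intro exI[of _ "\<lambda>c. P (\<tau> c)"]) (simp add: tof P act1 \<tau>\<tau>)
qed

lemma wf_multi_ctrl:
  assumes "p < w" "t < w" "p \<noteq> t" "p \<notin> set ls" "t \<notin> set ls" "\<forall>l\<in>set ls. l < w"
    and "unitary_mat 2 U"
  shows "\<forall>g\<in>set (multi_ctrl U t ls w p s). wf_gate g"
  using assms
proof (induction ls arbitrary: w p s)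
  case (Cons l ls)
  have "\<forall>g\<in>set (multi_ctrl U t ls (Suc w) w True). wf_gate g"
    by (rule Cons.IH) (use Cons.prems in auto)
  then show ?case using Cons.prems by (auto intro: wf_toffoli[of p l w])
qed (auto intro: wf_cgate)

lemma length_multi_ctrl: "length (multi_ctrl U t ls w p s) = 10 * length ls + 1"
  by (induction ls arbitrary: w p s) auto

text \<open>A swap is three alternating CNOT gates; giving each of them the second control
  \<open>p\<close> makes the whole swap controlled.\<close>

definition cswap :: "bool \<Rightarrow> nat \<Rightarrow> nat \<Rightarrow> nat \<Rightarrow> qgate list" where
  "cswap s p a b = toffoli s p True a b @ toffoli s p True b a @ toffoli s p True a b"

lemma run_cswap:
  assumes "p \<noteq> a" "p \<noteq> b" "a \<noteq> b"
  shows "run (cswap s p a b) \<Psi> c = \<Psi> (if c p = s then c(a := c b, b := c a) else c)"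
  unfolding cswap_def fold_append o_apply
  using assms
  by (cases "c p = s"; cases "c a"; cases "c b") (simp_all add: run_toffoli fun_upd_twist[of a b] fun_upd_idem)

lemma wf_cswap: "p \<noteq> a \<Longrightarrow> p \<noteq> b \<Longrightarrow> a \<noteq> b \<Longrightarrow> g \<in> set (cswap s p a b) \<Longrightarrow> wf_gate g"
  by (auto simp: cswap_def intro: wf_toffoli)

lemma length_cswap [simp]: "length (cswap s p a b) = 15"
  by (simp add: cswap_def)

section \<open>Hadamard transform of a register\<close>

definition hadamards :: "nat \<Rightarrow> qgate list" where
  "hadamards m = map (\<lambda>i. Gate hadamard [i]) [0..<m]"

definition zero_state :: qstate where
  "zero_state c = of_bool (\<forall>l. \<not> c l)"

definition uniform_state :: "nat \<Rightarrow> qstate" where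
  "uniform_state m c = of_bool (\<forall>l\<ge>m. \<not> c l) / sqrt (2 ^ m)"

lemma run_hadamards_Suc: "run (hadamards (Suc m)) \<Psi> = act1 hadamard m (run (hadamards m) \<Psi>)"
  by (simp add: hadamards_def act_Gate1)

lemma run_hadamards_0: "run (hadamards 0) \<Psi> = \<Psi>"
  by (simp add: hadamards_def)

lemma act1_run_hadamards:
  "m \<le> q \<Longrightarrow> act1 U q (run (hadamards m) \<Psi>) = run (hadamards m) (act1 U q \<Psi>)"
proof (induction m)
  case (Suc m)
  then show ?case by (simp add: run_hadamards_Suc act1_commute[of q m])
qed (simp add: run_hadamards_0)

lemma run_hadamards_twice: "run (hadamards m) (run (hadamards m) \<Psi>) = \<Psi>"
proof (induction m)
  case (Suc m)
  have "hadamard \<in> carrier_mat 2 2" by (simp add: hadamard_def)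
  then show ?case
    by (simp add: run_hadamards_Suc act1_run_hadamards[symmetric] Suc.IH act1_act1 hadamard_mult act1_one)
qed (simp add: run_hadamards_0)

lemma run_hadamards_zero_state: "run (hadamards m) zero_state = uniform_state m"
proof (induction m)
  case (Suc m)
  have "(\<forall>l\<ge>m. \<not> (c(m := False)) l) \<longleftrightarrow> (\<forall>l\<ge>Suc m. \<not> c l)" for c :: "nat \<Rightarrow> bool"
    by (auto simp: Suc_le_eq)
  moreover have "\<not> (\<forall>l\<ge>m. \<not> (c(m := True)) l)" for c :: "nat \<Rightarrow> bool"
    by auto
  ultimately have "act1 hadamard m (uniform_state m) = uniform_state (Suc m)"
    by (auto simp: fun_eq_iff act1_def hadamard_def uniform_state_def real_sqrt_mult of_bool_def)
  then show ?case by (simp add: run_hadamards_Suc Suc.IH)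
qed (auto simp: run_hadamards_0 uniform_state_def zero_state_def fun_eq_iff)

lemma run_hadamards_uniform_state: "run (hadamards m) (uniform_state m) = zero_state"
  by (metis run_hadamards_twice run_hadamards_zero_state)

text \<open>This amplitude is the inner product with the uniform vector, the only data about the
  input on which the rotation depends.\<close>

lemma run_hadamards_at_zero:
  assumes "\<And>l. l < m \<Longrightarrow> \<not> c l"
  shows "run (hadamards m) \<Psi> c = (\<Sum>w | \<forall>l\<ge>m. w l = c l. \<Psi> w) / sqrt (2 ^ m)"
  using assms
proof (induction m arbitrary: c)
  case 0
  have "{w. \<forall>l\<ge>0. w l = c l} = {c}" by auto
  then show ?case by (simp add: run_hadamards_0)
next
  case (Suc m)
  \<comment> \<open>A sum over an infinite set is 0 by convention, so finiteness has to be secured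
    before the sum is split at qubit \<open>m\<close>.\<close>
  have fin: "finite {w :: nat \<Rightarrow> bool. \<forall>l\<ge>m. w l = c l}" for m and c :: "nat \<Rightarrow> bool"
  proof (rule finite_subset)
    show "{w. \<forall>l\<ge>m. w l = c l} \<subseteq> (\<lambda>A l. if l < m then l \<in> A else c l) ` Pow {..<m}"
    proof
      fix w assume "w \<in> {w. \<forall>l\<ge>m. w l = c l}"
      then have "w = (\<lambda>l. if l < m then l \<in> {l. l < m \<and> w l} else c l)" by auto
      then show "w \<in> (\<lambda>A l. if l < m then l \<in> A else c l) ` Pow {..<m}" by blast
    qed
  qed simp
  have split: "{w. \<forall>l\<ge>Suc m. w l = c l} =
      {w. \<forall>l\<ge>m. w l = (c(m := False)) l} \<union> {w. \<forall>l\<ge>m. w l = (c(m := True)) l}" (is "_ = ?A \<union> ?B")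
    by (auto simp: Suc_le_eq)
  have disj: "?A \<inter> ?B = {}" by force
  have "\<not> c m" using Suc.prems by simp
  then have "run (hadamards (Suc m)) \<Psi> c =
      (run (hadamards m) \<Psi> (c(m := False)) + run (hadamards m) \<Psi> (c(m := True))) / sqrt 2"
    by (simp add: run_hadamards_Suc act1_def hadamard_def add_divide_distrib)
  also have "\<dots> = (sum \<Psi> ?A + sum \<Psi> ?B) / sqrt (2 ^ Suc m)"
    using Suc.prems by (simp add: Suc.IH real_sqrt_mult add_divide_distrib mult.commute)
  also have "sum \<Psi> ?A + sum \<Psi> ?B = (\<Sum>w | \<forall>l\<ge>Suc m. w l = c l. \<Psi> w)"
    unfolding split by (rule sum.union_disjoint[symmetric, OF fin fin disj])
  finally show ?case .
qed

lemma wf_hadamards: "\<forall>g\<in>set (hadamards m). wf_gate g"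
  by (auto simp: hadamards_def intro: wf_Gate1)

lemma length_hadamards [simp]: "length (hadamards m) = m"
  by (simp add: hadamards_def)

section \<open>The circuit on two registers\<close>

definition supported :: "nat \<Rightarrow> qstate \<Rightarrow> bool" where
  "supported m \<Psi> \<longleftrightarrow> (\<forall>c l. m \<le> l \<longrightarrow> c l \<longrightarrow> \<Psi> c = 0)"

lemma supportedD: "supported m \<Psi> \<Longrightarrow> m \<le> l \<Longrightarrow> c l \<Longrightarrow> \<Psi> c = 0"
  by (auto simp: supported_def)

lemma supported_mono: "supported m \<Psi> \<Longrightarrow> m \<le> n \<Longrightarrow> supported n \<Psi>"
  by (meson supported_def le_trans)

lemma supported_zero_state: "supported m zero_state"
  by (auto simp: supported_def zero_state_def)

lemma supported_uniform_state: "supported m (uniform_state m)"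
  by (auto simp: supported_def uniform_state_def)

lemma supported_linear: "supported m \<Psi> \<Longrightarrow> supported m \<Phi> \<Longrightarrow> supported m (\<lambda>c. \<Psi> c + a * \<Phi> c)"
  by (auto simp: supported_def)

lemma supported_run:
  assumes "supported m \<Psi>" and gs: "\<And>g. g \<in> set gs \<Longrightarrow> set (gate_qubits g) \<subseteq> {..<m}"
  shows "supported m (run gs \<Psi>)"
  unfolding supported_def
proof clarify
  fix c l assume l: "m \<le> l" "c l"
  have "run gs \<Psi> c = run gs (\<lambda>_. 0) c"
  proof (rule run_cong[OF gs])
    show "\<Psi> c' = 0" if "\<And>l. l \<notin> {..<m} \<Longrightarrow> c' l = c l" for c'
      using supportedD[OF assms(1) l(1), of c'] that[of l] l by auto
  qed
  then show "run gs \<Psi> c = 0" by simp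
qed

lemma supported_hadamards: "supported m \<Psi> \<Longrightarrow> supported m (run (hadamards m) \<Psi>)"
  by (rule supported_run) (auto simp: hadamards_def)

text \<open>A flag qubit \<open>f\<close> and two registers, the qubits \<open>r1 i\<close> and \<open>r2 i\<close>; in each of them the first
  \<open>M\<close> qubits carry data and the others are ancillas.\<close>

locale two_registers =
  fixes M f w0 :: nat and r1 r2 :: "nat \<Rightarrow> nat"
  assumes inj1: "inj r1" and inj2: "inj r2" and disj: "r1 i \<noteq> r2 j"
    and f1: "f \<noteq> r1 i" and f2: "f \<noteq> r2 i"
    and cover: "l = f \<or> l \<in> range r1 \<or> l \<in> range r2"
    and w1: "i < M \<Longrightarrow> r1 i < w0" and w2: "i < M \<Longrightarrow> r2 i < w0" and wf: "f < w0"
begin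

lemmas neqs [simp] = disj disj[symmetric] f1 f2 f1[symmetric] f2[symmetric] inj_eq[OF inj1] inj_eq[OF inj2]

lemma config_eqI:
  assumes "c f = c' f" "\<And>i. c (r1 i) = c' (r1 i)" "\<And>i. c (r2 i) = c' (r2 i)"
  shows "c = c'"
proof
  fix l show "c l = c' l" using cover[of l] assms by auto
qed

text \<open>The first two factors describe the registers when the flag is 0, the last two when it is 1.\<close>

definition branch :: "qstate \<Rightarrow> qstate \<Rightarrow> qstate \<Rightarrow> qstate \<Rightarrow> qstate" where
  "branch \<alpha>1 \<alpha>2 \<beta>1 \<beta>2 c = (if c f then \<beta>1 (c \<circ> r1) * \<beta>2 (c \<circ> r2) else \<alpha>1 (c \<circ> r1) * \<alpha>2 (c \<circ> r2))"

text \<open>For fixed flag and fixed second register the state is a scalar multiple of a state of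
  the first register, so linearity preserves the product form within each branch.\<close>

lemma run_relocate1:
  "run (map (relocate r1) gs) (branch \<alpha>1 \<alpha>2 \<beta>1 \<beta>2) = branch (run gs \<alpha>1) \<alpha>2 (run gs \<beta>1) \<beta>2"
proof
  fix c
  have "plug r1 c z f = c f" "plug r1 c z \<circ> r2 = c \<circ> r2" for z
    by (auto simp: plug_def fun_eq_iff)
  then show "run (map (relocate r1) gs) (branch \<alpha>1 \<alpha>2 \<beta>1 \<beta>2) c = branch (run gs \<alpha>1) \<alpha>2 (run gs \<beta>1) \<beta>2 c"
    using run_scale[of gs "\<alpha>2 (c \<circ> r2)" \<alpha>1] run_scale[of gs "\<beta>2 (c \<circ> r2)" \<beta>1]
    by (simp add: run_relocate inj1 branch_def plug_comp mult.commute)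
qed

lemma run_relocate2:
  "run (map (relocate r2) gs) (branch \<alpha>1 \<alpha>2 \<beta>1 \<beta>2) = branch \<alpha>1 (run gs \<alpha>2) \<beta>1 (run gs \<beta>2)"
proof
  fix c
  have "plug r2 c z f = c f" "plug r2 c z \<circ> r1 = c \<circ> r1" for z
    by (auto simp: plug_def fun_eq_iff)
  then show "run (map (relocate r2) gs) (branch \<alpha>1 \<alpha>2 \<beta>1 \<beta>2) c = branch \<alpha>1 (run gs \<alpha>2) \<beta>1 (run gs \<beta>2) c"
    by (simp add: run_relocate inj2 branch_def plug_comp run_scale)
qed

section \<open>Operations controlled by the flag\<close>

definition ctrl_hadamards :: "bool \<Rightarrow> (nat \<Rightarrow> nat) \<Rightarrow> nat \<Rightarrow> qgate list" where
  "ctrl_hadamards s r m = map (cgate s hadamard f) (map r [0..<m])"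

lemma run_ctrl_hadamards:
  assumes "f \<notin> range r"
  shows "run (ctrl_hadamards s r m) \<Psi> c =
    (if c f = s then run (map (relocate r) (hadamards m)) \<Psi> c else \<Psi> c)"
proof -
  have "f \<notin> set (map r [0..<m])" using assms by auto
  then show ?thesis unfolding ctrl_hadamards_def
    by (subst run_controlled) (auto simp: hadamards_def relocate_def o_def)
qed

lemma run_ctrl_hadamards1:
  "run (ctrl_hadamards False r1 m) (branch \<alpha>1 \<alpha>2 \<beta>1 \<beta>2) = branch (run (hadamards m) \<alpha>1) \<alpha>2 \<beta>1 \<beta>2"
  "run (ctrl_hadamards True r1 m) (branch \<alpha>1 \<alpha>2 \<beta>1 \<beta>2) = branch \<alpha>1 \<alpha>2 (run (hadamards m) \<beta>1) \<beta>2"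
  by (auto simp: fun_eq_iff run_ctrl_hadamards run_relocate1 image_iff) (simp_all add: branch_def)

lemma run_ctrl_hadamards2:
  "run (ctrl_hadamards False r2 m) (branch \<alpha>1 \<alpha>2 \<beta>1 \<beta>2) = branch \<alpha>1 (run (hadamards m) \<alpha>2) \<beta>1 \<beta>2"
  "run (ctrl_hadamards True r2 m) (branch \<alpha>1 \<alpha>2 \<beta>1 \<beta>2) = branch \<alpha>1 \<alpha>2 \<beta>1 (run (hadamards m) \<beta>2)"
  by (auto simp: fun_eq_iff run_ctrl_hadamards run_relocate2 image_iff) (simp_all add: branch_def)

lemma wf_ctrl_hadamards: "f \<notin> range r \<Longrightarrow> \<forall>g\<in>set (ctrl_hadamards s r m). wf_gate g"
  by (auto simp: ctrl_hadamards_def intro!: wf_cgate)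

definition cswaps :: "nat \<Rightarrow> qgate list" where
  "cswaps k = concat (map (\<lambda>i. cswap False f (r1 i) (r2 i)) [0..<k])"

text \<open>States are pulled back along permutations, so the last gate of the circuit acts on the
  configuration first.\<close>

fun swapped :: "nat \<Rightarrow> (nat \<Rightarrow> bool) \<Rightarrow> nat \<Rightarrow> bool" where
  "swapped 0 c = c"
| "swapped (Suc k) c = swapped k (if c f then c else c(r1 k := c (r2 k), r2 k := c (r1 k)))"

lemma run_cswaps: "run (cswaps k) \<Psi> c = \<Psi> (swapped k c)"
proof (induction k arbitrary: c)
  case (Suc k)
  have "cswaps (Suc k) = cswaps k @ cswap False f (r1 k) (r2 k)" by (simp add: cswaps_def)
  then have "run (cswaps (Suc k)) \<Psi> c =
      run (cswaps k) \<Psi> (if c f = False then c(r1 k := c (r2 k), r2 k := c (r1 k)) else c)"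
    unfolding fold_append o_apply by (simp only: fold_append o_apply) (rule run_cswap, simp_all)
  also have "\<dots> = \<Psi> (swapped (Suc k) c)"
    by (subst Suc.IH) (cases "c f"; simp only: swapped.simps if_True if_False simp_thms)
  finally show ?case .
qed (simp add: cswaps_def)

lemma swapped_simps:
  "swapped k c f = c f"
  "swapped k c (r1 i) = (if \<not> c f \<and> i < k then c (r2 i) else c (r1 i))"
  "swapped k c (r2 i) = (if \<not> c f \<and> i < k then c (r1 i) else c (r2 i))"
  by (induction k arbitrary: c) (auto simp: less_Suc_eq)

lemma zero_state_eq_0: "c l \<Longrightarrow> zero_state c = 0"
  by (auto simp: zero_state_def)

text \<open>Exchanging the \<open>M\<close> data qubits amounts to exchanging the registers, because
  amplitudes with a set ancilla vanish on both sides. The swap fires on flag 0 alone: the input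
  occupies register 2 for either flag value, and only the first graph has to move to register
  1.\<close>

lemma run_cswaps_branch:
  assumes "supported M \<alpha>"
  shows "run (cswaps M) (branch zero_state \<alpha> zero_state \<beta>) = branch \<alpha> zero_state zero_state \<beta>" (is ?A)
    and "run (cswaps M) (branch \<alpha> zero_state zero_state \<beta>) = branch zero_state \<alpha> zero_state \<beta>" (is ?B)
proof -
  have *: "zero_state (swapped M c \<circ> r1) * \<alpha> (swapped M c \<circ> r2) = \<alpha> (c \<circ> r1) * zero_state (c \<circ> r2) \<and>
      \<alpha> (swapped M c \<circ> r1) * zero_state (swapped M c \<circ> r2) = zero_state (c \<circ> r1) * \<alpha> (c \<circ> r2)"
    if "\<not> c f" for c
  proof (cases "\<exists>i\<ge>M. c (r1 i) \<or> c (r2 i)")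
    case True
    then obtain i where i: "i \<ge> M" "c (r1 i) \<or> c (r2 i)" by blast
    have z: "\<alpha> z1 * zero_state z2 = 0" "zero_state z2 * \<alpha> z1 = 0" if "z1 i \<or> z2 i" for z1 z2
      using that supportedD[OF assms i(1)] zero_state_eq_0 by auto
    have "(swapped M c \<circ> r1) i \<or> (swapped M c \<circ> r2) i" "(c \<circ> r1) i \<or> (c \<circ> r2) i"
      using i by (auto simp: swapped_simps)
    then show ?thesis using z by metis
  next
    case False
    then have "swapped M c \<circ> r1 = c \<circ> r2" "swapped M c \<circ> r2 = c \<circ> r1"
      using that by (auto simp: fun_eq_iff swapped_simps)
    then show ?thesis by simp
  qed
  have **: "swapped M c = c" if "c f" for c
    by (rule config_eqI) (use that in \<open>auto simp: swapped_simps\<close>)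
  show ?A ?B
    by (rule ext, simp add: run_cswaps branch_def swapped_simps * **)+
qed

lemma wf_cswaps: "\<forall>g\<in>set (cswaps k). wf_gate g"
  by (auto simp: cswaps_def intro: wf_cswap[OF f1 f2 disj])

lemma length_cswaps: "length (cswaps k) = 15 * k"
  by (induction k) (simp_all add: cswaps_def)

text \<open>The chain of controls starts at \<open>w0\<close>, an ancilla in state |0> that fires on
  \<open>False\<close> and is thus always satisfied; the work qubits begin at \<open>Suc w0\<close>.
  They are shared with the ancillas of the two registers, which are all |0> at this stage.\<close>

definition rotation :: "complex mat \<Rightarrow> nat \<Rightarrow> nat \<Rightarrow> qgate list" where
  "rotation U m1 m2 = multi_ctrl U f (map r1 [0..<m1] @ map r2 [0..<m2]) (Suc w0) w0 False"

lemma controls_less: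
  assumes "m1 \<le> M" "m2 \<le> M"
  shows "\<forall>l\<in>set (map r1 [0..<m1] @ map r2 [0..<m2]). l < w0"
  using w1[OF less_le_trans[OF _ assms(1)]] w2[OF less_le_trans[OF _ assms(2)]] by auto

lemma rotation_distinct:
  assumes "m1 \<le> M" "m2 \<le> M"
  shows "w0 < Suc w0" "f < Suc w0" "w0 \<noteq> f" "w0 \<notin> set (map r1 [0..<m1] @ map r2 [0..<m2])"
    "f \<notin> set (map r1 [0..<m1] @ map r2 [0..<m2])"
    "\<forall>l\<in>set (map r1 [0..<m1] @ map r2 [0..<m2]). l < Suc w0"
proof -
  show "w0 \<notin> set (map r1 [0..<m1] @ map r2 [0..<m2])"
    using controls_less[OF assms] by blast
  show "\<forall>l\<in>set (map r1 [0..<m1] @ map r2 [0..<m2]). l < Suc w0"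
    using controls_less[OF assms] less_SucI by blast
qed (use wf in auto)

text \<open>The flag is rotated only where all data qubits are zero, and there the branches have
  amplitudes \<open>\<alpha> z0\<close> and \<open>\<beta> z0\<close>. The change is a multiple of
  \<open>zero_state\<close> in the active register, so each branch remains a product.\<close>

lemma run_rotation:
  fixes C S :: complex
  assumes \<alpha>: "supported m1 \<alpha>" and \<beta>: "supported m2 \<beta>" and m: "m1 \<le> M" "m2 \<le> M"
  defines "z0 \<equiv> \<lambda>_. False"
  defines "\<kappa>1 \<equiv> (C - 1) * \<alpha> z0 + S * \<beta> z0" and "\<kappa>2 \<equiv> (C - 1) * \<beta> z0 + S * \<alpha> z0"
  shows "run (rotation (mat2 C S S C) m1 m2) (branch \<alpha> zero_state zero_state \<beta>) =
    branch (\<lambda>c. \<alpha> c + \<kappa>1 * zero_state c) zero_state zero_state (\<lambda>c. \<beta> c + \<kappa>2 * zero_state c)"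
    (is "run _ ?\<Psi> = branch ?\<alpha>' _ _ ?\<beta>'")
proof
  fix c
  let ?ls = "map r1 [0..<m1] @ map r2 [0..<m2]" and ?U = "mat2 C S S C"
  obtain P where P: "\<And>\<Psi> c. run (rotation ?U m1 m2) \<Psi> c = (if P c then act1 ?U f \<Psi> c else \<Psi> c)"
    and P': "\<And>c. (\<forall>j\<ge>Suc w0. \<not> c j) \<Longrightarrow> P c = (c w0 = False \<and> (\<forall>l\<in>set ?ls. \<not> c l))"
    using run_multi_ctrl[OF rotation_distinct[OF m], of ?U False] unfolding rotation_def by blast
  have \<alpha>': "supported m1 ?\<alpha>'" and \<beta>': "supported m2 ?\<beta>'"
    using \<alpha> \<beta> by (auto intro: supported_linear supported_zero_state)
  show "run (rotation ?U m1 m2) ?\<Psi> c = branch ?\<alpha>' zero_state zero_state ?\<beta>' c"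
  \<comment> \<open>If a qubit other than the flag and the controls is set, nothing is known about
    \<open>P\<close>. But all amplitudes reachable by changing the flag are then 0, so either value
    of \<open>P\<close> gives the same result.\<close>
  proof (cases "\<exists>l. c l \<and> l \<noteq> f \<and> l \<notin> set ?ls")
    case True
    then obtain l where l: "c l" "l \<noteq> f" "l \<notin> set ?ls" by blast
    have z: "branch \<alpha>'' zero_state zero_state \<beta>'' c' = 0"
      if "c' l" "supported m1 \<alpha>''" "supported m2 \<beta>''" for c' \<alpha>'' \<beta>''
    proof -
      consider i where "l = r1 i" | i where "l = r2 i" using cover[of l] l(2) by auto
      then show ?thesis
      proof cases
        case (1 i)
        then have "i \<ge> m1" using l(3) by (auto intro: leI)
        then show ?thesis
          using 1 that(1) supportedD[OF that(2), of i "c' \<circ> r1"] zero_state_eq_0[of "c' \<circ> r1" i]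
          by (simp add: branch_def)
      next
        case (2 i)
        then have "i \<ge> m2" using l(3) by (auto intro: leI)
        then show ?thesis
          using 2 that(1) supportedD[OF that(3), of i "c' \<circ> r2"] zero_state_eq_0[of "c' \<circ> r2" i]
          by (simp add: branch_def)
      qed
    qed
    show ?thesis
      using l(1,2) z \<alpha> \<beta> \<alpha>' \<beta>' by (simp add: P act1_def)
  next
    case False
    have "w0 \<le> j \<Longrightarrow> \<not> c j" for j
      using False controls_less[OF m] wf by (metis leD)
    then have Pc: "P c \<longleftrightarrow> (\<forall>l\<in>set ?ls. \<not> c l)" by (auto simp: P')
    show ?thesis
    proof (cases "\<forall>l\<in>set ?ls. \<not> c l")
      case True
      then have "c l \<Longrightarrow> l = f" for l using False by blast
      then have o: "c(f := x) \<circ> r1 = z0" "c(f := x) \<circ> r2 = z0" "c \<circ> r1 = z0" "c \<circ> r2 = z0" for x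
        by (auto simp: z0_def fun_eq_iff) (metis f1 f2)+
      have "zero_state z0 = 1" by (simp add: zero_state_def z0_def)
      then show ?thesis
        using True by (simp add: P Pc act1_def branch_def o \<kappa>1_def \<kappa>2_def algebra_simps)
    next
      case nz: False
      then have "zero_state (c \<circ> r1) * zero_state (c \<circ> r2) = 0"
        using zero_state_eq_0[of "c \<circ> r1"] zero_state_eq_0[of "c \<circ> r2"] by force
      then show ?thesis using nz by (auto simp: P Pc branch_def algebra_simps)
    qed
  qed
qed

text \<open>The uncontrolled Hadamards after the rotation do two things at once: they undo the
  controlled ones on the active register and make the idle register uniform. The scalar gate on the
  flag is a global phase that removes the eigenvalue contributed by the idle register, which the
  last controlled Hadamards then return to zero.\<close>

definition walk_circuit :: "complex mat \<Rightarrow> complex \<Rightarrow> nat \<Rightarrow> nat \<Rightarrow> qgate list \<Rightarrow> qgate list \<Rightarrow> qgate list" where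
  "walk_circuit U \<nu> m1 m2 gs1 gs2 =
     cswaps M @ ctrl_hadamards False r1 m1 @ ctrl_hadamards True r2 m2 @ rotation U m1 m2 @
     map (relocate r1) (hadamards m1) @ map (relocate r2) (hadamards m2) @
     map (relocate r1) gs1 @ map (relocate r2) gs2 @ [Gate (mat2 \<nu> 0 0 \<nu>) [f]] @
     ctrl_hadamards False r2 m2 @ ctrl_hadamards True r1 m1 @ cswaps M"

text \<open>\<open>a\<close> and \<open>b\<close> are the components of the input along the uniform
  vectors. The rotation adds a multiple of \<open>zero_state\<close>, the Hadamards turn it into the
  same multiple of the uniform state, and the walk multiplies that by its eigenvalue
  \<open>\<mu>\<close>.\<close>

lemma run_walk_circuit:
  fixes C S \<mu> :: complex
  assumes \<alpha>: "supported m1 \<alpha>" "supported m1 (run gs1 \<alpha>)"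
    and \<beta>: "supported m2 \<beta>" "supported m2 (run gs2 \<beta>)" and m: "m1 \<le> M" "m2 \<le> M"
    and gs1: "run gs1 (uniform_state m1) = (\<lambda>c. \<mu> * uniform_state m1 c)"
    and gs2: "run gs2 (uniform_state m2) = (\<lambda>c. \<mu> * uniform_state m2 c)"
    and \<nu>: "\<nu> * \<mu> = 1"
  defines "a \<equiv> run (hadamards m1) \<alpha> (\<lambda>_. False)" and "b \<equiv> run (hadamards m2) \<beta> (\<lambda>_. False)"
  shows "run (walk_circuit (mat2 C S S C) \<nu> m1 m2 gs1 gs2) (branch zero_state \<alpha> zero_state \<beta>) =
    branch zero_state (\<lambda>c. run gs1 \<alpha> c + \<mu> * ((C - 1) * a + S * b) * uniform_state m1 c)
           zero_state (\<lambda>c. run gs2 \<beta> c + \<mu> * ((C - 1) * b + S * a) * uniform_state m2 c)"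
proof -
  define \<kappa>1 \<kappa>2 where "\<kappa>1 = (C - 1) * a + S * b" and "\<kappa>2 = (C - 1) * b + S * a"
  define \<alpha>' where "\<alpha>' c = run gs1 \<alpha> c + \<mu> * \<kappa>1 * uniform_state m1 c" for c
  define \<beta>' where "\<beta>' c = run gs2 \<beta> c + \<mu> * \<kappa>2 * uniform_state m2 c" for c
  have 1: "run (cswaps M) (branch zero_state \<alpha> zero_state \<beta>) = branch \<alpha> zero_state zero_state \<beta>"
    using supported_mono[OF \<alpha>(1) m(1)] by (rule run_cswaps_branch)
  have 2: "run (rotation (mat2 C S S C) m1 m2)
        (branch (run (hadamards m1) \<alpha>) zero_state zero_state (run (hadamards m2) \<beta>)) =
      branch (\<lambda>c. run (hadamards m1) \<alpha> c + \<kappa>1 * zero_state c) zero_state zero_state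
        (\<lambda>c. run (hadamards m2) \<beta> c + \<kappa>2 * zero_state c)"
    using run_rotation[OF supported_hadamards[OF \<alpha>(1)] supported_hadamards[OF \<beta>(1)] m, of C S]
    by (simp add: \<kappa>1_def \<kappa>2_def a_def b_def)
  have lin: "run gs (\<lambda>c. \<Psi> c + x * \<Phi> c) = (\<lambda>c. run gs \<Psi> c + x * run gs \<Phi> c)" for gs \<Psi> \<Phi> x
    using run_linear[of gs 1 \<Psi> x \<Phi>] by simp
  have 3: "act (Gate (mat2 \<nu> 0 0 \<nu>) [f]) (branch (\<lambda>c. run gs1 \<alpha> c + \<kappa>1 * (\<mu> * uniform_state m1 c))
        (\<lambda>c. \<mu> * uniform_state m2 c) (\<lambda>c. \<mu> * uniform_state m1 c)
        (\<lambda>c. run gs2 \<beta> c + \<kappa>2 * (\<mu> * uniform_state m2 c))) =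
      branch \<alpha>' (uniform_state m2) (uniform_state m1) \<beta>'"
  proof
    fix c
    have c: "c(f := True) = c" if "c f" using that by (simp add: fun_upd_idem)
    have c': "c(f := False) = c" if "\<not> c f" using that by (simp add: fun_upd_idem)
    have *: "\<nu> * (x * (\<mu> * y)) = x * y" "\<nu> * (\<mu> * x * y) = x * y" for x y
      using \<nu> \<nu>[unfolded mult.commute[of \<nu>]] by (simp_all add: mult.left_commute flip: mult.assoc)
    show "act (Gate (mat2 \<nu> 0 0 \<nu>) [f]) (branch (\<lambda>c. run gs1 \<alpha> c + \<kappa>1 * (\<mu> * uniform_state m1 c))
        (\<lambda>c. \<mu> * uniform_state m2 c) (\<lambda>c. \<mu> * uniform_state m1 c)
        (\<lambda>c. run gs2 \<beta> c + \<kappa>2 * (\<mu> * uniform_state m2 c))) c =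
      branch \<alpha>' (uniform_state m2) (uniform_state m1) \<beta>' c"
      by (cases "c f") (simp_all add: act_Gate1 act1_def c c' branch_def \<alpha>'_def \<beta>'_def * mult.left_commute[of \<mu>])
  qed
  have 4: "run (cswaps M) (branch \<alpha>' zero_state zero_state \<beta>') = branch zero_state \<alpha>' zero_state \<beta>'"
    unfolding \<alpha>'_def
    by (rule run_cswaps_branch, rule supported_mono[OF supported_linear[OF \<alpha>(2) supported_uniform_state] m(1)])
  show ?thesis
    unfolding walk_circuit_def fold_append o_apply 1
    unfolding run_ctrl_hadamards1 run_ctrl_hadamards2 2
    unfolding run_relocate1 run_relocate2 lin run_hadamards_twice run_hadamards_zero_state gs1 gs2
    by (simp add: 3 4 run_ctrl_hadamards1 run_ctrl_hadamards2 run_hadamards_uniform_state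
        flip: \<kappa>1_def \<kappa>2_def \<alpha>'_def \<beta>'_def)
qed

lemma wf_walk_circuit:
  assumes m: "m1 \<le> M" "m2 \<le> M" and U: "unitary_mat 2 U" and \<nu>: "cnj \<nu> * \<nu> = 1"
    and "\<forall>g\<in>set gs1. wf_gate g" "\<forall>g\<in>set gs2. wf_gate g"
  shows "\<forall>g\<in>set (walk_circuit U \<nu> m1 m2 gs1 gs2). wf_gate g"
proof -
  have "f \<notin> range r1" "f \<notin> range r2" by (auto simp: image_iff)
  moreover have "unitary_mat 2 (mat2 \<nu> 0 0 \<nu>)" using \<nu> by (simp add: unitary_mat2_iff)
  moreover have "\<forall>g\<in>set (rotation U m1 m2). wf_gate g"
    unfolding rotation_def by (rule wf_multi_ctrl[OF rotation_distinct[OF m] U])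
  ultimately show ?thesis
    using wf_cswaps wf_ctrl_hadamards assms(5,6) wf_hadamards
    by (auto simp: walk_circuit_def intro: wf_relocate inj1 inj2 wf_Gate1)
qed

text \<open>Two rounds of swaps at 15 gates per data qubit give 30. Each control qubit costs 10
  gates in the rotation and three Hadamards, which gives 13. The 2 is the innermost controlled gate
  of the rotation and the phase gate.\<close>

lemma length_walk_circuit:
  "length (walk_circuit U \<nu> m1 m2 gs1 gs2) = 30 * M + 13 * (m1 + m2) + 2 + length gs1 + length gs2"
  by (simp add: walk_circuit_def ctrl_hadamards_def length_cswaps rotation_def length_multi_ctrl)

end

section \<open>The exponential of the interconnected network\<close>

text \<open>Regularity in the form used by matrix products with an all-ones block: row sums for a
  block on the right, column sums for one on the left. Symmetry of an adjacency matrix makes the two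
  agree.\<close>

definition regular_mat :: "nat \<Rightarrow> complex \<Rightarrow> complex mat \<Rightarrow> bool" where
  "regular_mat n d A \<longleftrightarrow> A \<in> carrier_mat n n \<and>
     (\<forall>i<n. (\<Sum>j<n. A $$ (i, j)) = d) \<and> (\<forall>j<n. (\<Sum>i<n. A $$ (i, j)) = d)"

lemma regular_mat_adjacency_mat:
  assumes E: "undirected_graph n E" and d: "degree_regular n E d"
  shows "regular_mat n (of_nat d) (adjacency_mat n E)"
proof -
  have "(\<Sum>k<n. if {j, k} \<in> E then 1 else 0 :: complex) = of_nat d" if j: "j < n" for j
  proof -
    \<comment> \<open>A loop corresponds to k = j and is counted once on both sides.\<close>
    have "bij_betw (\<lambda>k. {j, k}) {k. k < n \<and> {j, k} \<in> E} {e \<in> E. j \<in> e}"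
    proof (rule bij_betwI')
      fix e assume e: "e \<in> {e \<in> E. j \<in> e}"
      moreover from this obtain u v where "u < n" "v < n" "e = {u, v}"
        using E unfolding undirected_graph_def by blast
      ultimately have "e = {j, v} \<or> e = {j, u}" by auto
      with \<open>u < n\<close> \<open>v < n\<close> e show "\<exists>k\<in>{k. k < n \<and> {j, k} \<in> E}. e = {j, k}" by auto
    qed (auto simp: doubleton_eq_iff)
    then have "card {k. k < n \<and> {j, k} \<in> E} = d"
      using d j by (simp add: degree_regular_def vertex_degree_def bij_betw_same_card)
    moreover have "(\<Sum>k<n. if {j, k} \<in> E then 1 else 0 :: complex) = of_nat (card {k. k < n \<and> {j, k} \<in> E})"
      by (simp add: sum.If_cases Int_def)
    ultimately show ?thesis by simp
  qed
  then show ?thesis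
    by (auto simp: regular_mat_def adjacency_mat_def insert_commute)
qed

section \<open>Powers of the block matrix and the exponential series\<close>

lemma sum_row_pow:
  assumes A: "regular_mat n d A" and i: "i < n"
  shows "(\<Sum>j<n. (A ^\<^sub>m k) $$ (i, j)) = d ^ k"
proof (induction k)
  case 0
  have "(\<Sum>j<n. 1\<^sub>m n $$ (i, j)) = (\<Sum>j<n. if i = j then 1 else 0 :: complex)"
    by (rule sum.cong) (use i in auto)
  then show ?case using A i by (auto simp: regular_mat_def)
next
  case (Suc k)
  have c: "A \<in> carrier_mat n n" using A by (simp add: regular_mat_def)
  have "(\<Sum>j<n. (A ^\<^sub>m Suc k) $$ (i, j)) = (\<Sum>j<n. \<Sum>l<n. (A ^\<^sub>m k) $$ (i, l) * A $$ (l, j))"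
    using i c pow_carrier_mat[OF c, of k] by (simp add: scalar_prod_def lessThan_atLeast0)
  also have "\<dots> = (\<Sum>l<n. \<Sum>j<n. (A ^\<^sub>m k) $$ (i, l) * A $$ (l, j))" by (rule sum.swap)
  also have "\<dots> = (\<Sum>l<n. (A ^\<^sub>m k) $$ (i, l) * d)"
    using A by (simp add: regular_mat_def flip: sum_distrib_left)
  finally show ?case by (simp add: Suc.IH flip: sum_distrib_right)
qed

text \<open>On the normalised uniform vectors the matrix acts as the 2 x 2 matrix with diagonal
  \<open>d\<close> and off-diagonal \<open>s\<close>, whose eigenvalues are \<open>d + s\<close> and
  \<open>d - s\<close>. Its k-th power gives \<open>e\<close> and \<open>h\<close>: the diagonal is
  corrected by \<open>d ^ k\<close>, which the powers of \<open>A\<close> and \<open>B\<close>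
  already contribute, and the projectors onto the uniform vectors account for the divisors
  \<open>n1\<close>, \<open>n2\<close> and \<open>s\<close>.\<close>

lemma complete_interconnection_pow:
  fixes d s :: complex
  assumes A: "regular_mat n1 d A" and B: "regular_mat n2 d B" and n: "n1 > 0" "n2 > 0"
    and s: "s * s = of_nat n1 * of_nat n2"
  defines "e \<equiv> \<lambda>k. ((d + s) ^ k + (d - s) ^ k) / 2 - d ^ k" and "h \<equiv> \<lambda>k. ((d + s) ^ k - (d - s) ^ k) / (2 * s)"
  shows "complete_interconnection A B ^\<^sub>m k = four_block_mat
    (mat n1 n1 (\<lambda>ij. (A ^\<^sub>m k) $$ ij + e k / of_nat n1)) (mat n1 n2 (\<lambda>_. h k))
    (mat n2 n1 (\<lambda>_. h k)) (mat n2 n2 (\<lambda>ij. (B ^\<^sub>m k) $$ ij + e k / of_nat n2))"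
proof (induction k)
  case 0
  have "dim_row A = n1" "dim_row B = n2" using A B by (auto simp: regular_mat_def)
  then show ?case
    by (auto intro!: eq_matI simp: complete_interconnection_def e_def h_def)
next
  case (Suc k)
  have cA: "A \<in> carrier_mat n1 n1" and cB: "B \<in> carrier_mat n2 n2" using A B by (auto simp: regular_mat_def)
  note dims = cA cB carrier_matD[OF cA] carrier_matD[OF cB] carrier_matD[OF pow_carrier_mat[OF cA, of k]]
    carrier_matD[OF pow_carrier_mat[OF cB, of k]]
  have s0: "s \<noteq> 0" using s n by auto
  have e: "e (Suc k) = d * e k + h k * s * s"
    using s0 by (simp add: e_def h_def field_simps)
  have e1: "e (Suc k) / of_nat n1 = e k / of_nat n1 * d + of_nat n2 * h k"
    and e2: "e (Suc k) / of_nat n2 = e k / of_nat n2 * d + of_nat n1 * h k"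
    using n unfolding e mult.assoc s by (simp_all add: field_simps)
  have h: "h (Suc k) = d ^ k + e k + h k * d"
    using s0 by (simp add: e_def h_def field_simps)
  have colA: "(\<Sum>i<n1. A $$ (i, j)) = d" if "j < n1" for j using A that by (simp add: regular_mat_def)
  have colB: "(\<Sum>i<n2. B $$ (i, j)) = d" if "j < n2" for j using B that by (simp add: regular_mat_def)
  let ?P = "mat n1 n1 (\<lambda>ij. (A ^\<^sub>m k) $$ ij + e k / of_nat n1)" and ?Q = "mat n1 n2 (\<lambda>_. h k)"
    and ?R = "mat n2 n1 (\<lambda>_. h k)" and ?T = "mat n2 n2 (\<lambda>ij. (B ^\<^sub>m k) $$ ij + e k / of_nat n2)"
  let ?J = all_ones_mat
  have "complete_interconnection A B ^\<^sub>m Suc k = four_block_mat ?P ?Q ?R ?T * four_block_mat A (?J n1 n2) (?J n2 n1) B"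
    by (simp add: Suc.IH) (simp add: complete_interconnection_def dims)
  also have "\<dots> = four_block_mat (?P * A + ?Q * ?J n2 n1) (?P * ?J n1 n2 + ?Q * B)
      (?R * A + ?T * ?J n2 n1) (?R * ?J n1 n2 + ?T * B)"
    by (rule mult_four_block_mat) (use cA cB in \<open>auto simp: all_ones_mat_def\<close>)
  also have "?P * A + ?Q * ?J n2 n1 = mat n1 n1 (\<lambda>ij. (A ^\<^sub>m Suc k) $$ ij + e (Suc k) / of_nat n1)"
    by (rule eq_matI) (auto simp: dims all_ones_mat_def scalar_prod_def e1 distrib_right sum.distrib
        colA simp flip: lessThan_atLeast0 sum_distrib_left sum_divide_distrib)
  also have "?P * ?J n1 n2 + ?Q * B = mat n1 n2 (\<lambda>_. h (Suc k))"
    using n by (intro eq_matI) (auto simp: dims all_ones_mat_def scalar_prod_def h sum.distrib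
        colB sum_row_pow[OF A] simp flip: lessThan_atLeast0 sum_distrib_left sum_divide_distrib)
  also have "?R * A + ?T * ?J n2 n1 = mat n2 n1 (\<lambda>_. h (Suc k))"
    using n by (intro eq_matI) (auto simp: dims all_ones_mat_def scalar_prod_def h sum.distrib
        colA sum_row_pow[OF B] simp flip: lessThan_atLeast0 sum_distrib_left sum_divide_distrib)
  also have "?R * ?J n1 n2 + ?T * B = mat n2 n2 (\<lambda>ij. (B ^\<^sub>m Suc k) $$ ij + e (Suc k) / of_nat n2)"
    by (rule eq_matI) (auto simp: dims all_ones_mat_def scalar_prod_def e2 distrib_right sum.distrib
        colB simp flip: lessThan_atLeast0 sum_distrib_left sum_divide_distrib)
  finally show ?case .
qed

lemma smult_pow_mat:
  fixes A :: "complex mat"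
  assumes A: "A \<in> carrier_mat n n"
  shows "(z \<cdot>\<^sub>m A) ^\<^sub>m k = z ^ k \<cdot>\<^sub>m (A ^\<^sub>m k)"
proof (induction k)
  case 0
  show ?case using A by (auto intro!: eq_matI)
next
  case (Suc k)
  have "(z \<cdot>\<^sub>m A) ^\<^sub>m Suc k = (z ^ k \<cdot>\<^sub>m (A ^\<^sub>m k)) * (z \<cdot>\<^sub>m A)" by (simp add: Suc.IH)
  also have "\<dots> = z ^ k \<cdot>\<^sub>m (z \<cdot>\<^sub>m (A ^\<^sub>m k * A))"
    unfolding mult_smult_assoc_mat[OF pow_carrier_mat[OF A] smult_carrier_mat[OF A]]
      mult_smult_distrib[OF pow_carrier_mat[OF A] A] ..
  also have "\<dots> = z ^ Suc k \<cdot>\<^sub>m (A ^\<^sub>m Suc k)"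
    by (rule eq_matI) auto
  finally show ?case .
qed

lemma mat_exp_smult_sums:
  fixes A :: "complex mat"
  assumes A: "A \<in> carrier_mat n n" and ij: "i < n" "j < n"
  shows "(\<lambda>k. z ^ k * (A ^\<^sub>m k) $$ (i, j) / fact k) sums (mat_exp (z \<cdot>\<^sub>m A) $$ (i, j))"
proof -
  have zA: "z \<cdot>\<^sub>m A \<in> carrier_mat n n" using A by simp
  have "(\<lambda>k. ((z \<cdot>\<^sub>m A) ^\<^sub>m k) $$ (i, j) / fact k) sums (mat_exp (z \<cdot>\<^sub>m A) $$ (i, j))"
    using summable_sums[OF summable_norm_cancel[OF summable_mat_exp[OF zA ij]]] A ij
    by (simp add: mat_exp_def)
  then show ?thesis
    using carrier_matD[OF pow_carrier_mat[OF A]] ij by (simp add: smult_pow_mat[OF A])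
qed

lemma exp_power_sums: "(\<lambda>k. z ^ k * x ^ k / fact k) sums exp (z * x :: complex)"
  using exp_converges[of "z * x"] by (simp add: power_mult_distrib scaleR_conv_of_real field_simps)

lemma mat_exp_carrier: "A \<in> carrier_mat n n \<Longrightarrow> mat_exp A \<in> carrier_mat n n"
  by (simp add: mat_exp_def)

lemma sum_row_mat_exp:
  assumes A: "regular_mat n d A" and i: "i < n"
  shows "(\<Sum>j<n. mat_exp (z \<cdot>\<^sub>m A) $$ (i, j)) = exp (z * d)"
proof -
  have c: "A \<in> carrier_mat n n" using A by (simp add: regular_mat_def)
  have "(\<lambda>k. \<Sum>j<n. z ^ k * (A ^\<^sub>m k) $$ (i, j) / fact k) sums (\<Sum>j<n. mat_exp (z \<cdot>\<^sub>m A) $$ (i, j))"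
    by (rule sums_sum, rule mat_exp_smult_sums[OF c i]) simp
  moreover have "(\<Sum>j<n. z ^ k * (A ^\<^sub>m k) $$ (i, j) / fact k) = z ^ k * d ^ k / fact k" for k
    by (simp add: sum_row_pow[OF A i] flip: sum_distrib_left sum_divide_distrib)
  ultimately show ?thesis using exp_power_sums[of z d] sums_unique2 by fastforce
qed

text \<open>The closed form of the powers is a linear combination of \<open>(d + s) ^ k\<close>,
  \<open>(d - s) ^ k\<close>, \<open>d ^ k\<close> and powers of the blocks, so the exponential
  series is summed term by term.\<close>

lemma mat_exp_complete_interconnection:
  fixes d s z :: complex
  assumes A: "regular_mat n1 d A" and B: "regular_mat n2 d B" and n: "n1 > 0" "n2 > 0"
    and s: "s * s = of_nat n1 * of_nat n2"
  defines "e \<equiv> (exp (z * (d + s)) + exp (z * (d - s))) / 2 - exp (z * d)"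
    and "h \<equiv> (exp (z * (d + s)) - exp (z * (d - s))) / (2 * s)"
  shows "mat_exp (z \<cdot>\<^sub>m complete_interconnection A B) = four_block_mat
    (mat n1 n1 (\<lambda>ij. mat_exp (z \<cdot>\<^sub>m A) $$ ij + e / of_nat n1)) (mat n1 n2 (\<lambda>_. h))
    (mat n2 n1 (\<lambda>_. h)) (mat n2 n2 (\<lambda>ij. mat_exp (z \<cdot>\<^sub>m B) $$ ij + e / of_nat n2))" (is "?L = ?R")
proof (rule eq_matI)
  have cA: "A \<in> carrier_mat n1 n1" and cB: "B \<in> carrier_mat n2 n2" using A B by (auto simp: regular_mat_def)
  define ek where "ek k = ((d + s) ^ k + (d - s) ^ k) / 2 - d ^ k" for k
  define hk where "hk k = ((d + s) ^ k - (d - s) ^ k) / (2 * s)" for k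
  note pow = complete_interconnection_pow[OF A B n s, folded ek_def hk_def]
  have e: "(\<lambda>k. z ^ k * ek k / fact k) sums e"
    using sums_diff[OF sums_divide[OF sums_add[OF exp_power_sums[of z "d + s"] exp_power_sums[of z "d - s"]], of 2]
        exp_power_sums[of z d]]
    unfolding e_def ek_def
    by (rule sums_cong[THEN iffD1, rotated]) (simp add: field_split_simps)
  have h: "(\<lambda>k. z ^ k * hk k / fact k) sums h"
    using sums_divide[OF sums_diff[OF exp_power_sums[of z "d + s"] exp_power_sums[of z "d - s"]], of "2 * s"]
    unfolding h_def hk_def
    by (rule sums_cong[THEN iffD1, rotated]) (simp add: field_split_simps)
  have c: "complete_interconnection A B \<in> carrier_mat (n1 + n2) (n1 + n2)"
    using cA cB by (auto simp: complete_interconnection_def)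
  fix i j assume "i < dim_row ?R" "j < dim_col ?R"
  then have ij: "i < n1 + n2" "j < n1 + n2" by auto
  note L = mat_exp_smult_sums[OF c ij, of z, unfolded pow]
  have "(\<lambda>k. z ^ k * four_block_mat
      (mat n1 n1 (\<lambda>ij. (A ^\<^sub>m k) $$ ij + ek k / of_nat n1)) (mat n1 n2 (\<lambda>_. hk k))
      (mat n2 n1 (\<lambda>_. hk k)) (mat n2 n2 (\<lambda>ij. (B ^\<^sub>m k) $$ ij + ek k / of_nat n2)) $$ (i, j) / fact k)
    sums (?R $$ (i, j))"
  proof -
    have 1: "(\<lambda>k. z ^ k * ((X ^\<^sub>m k) $$ (i', j') + ek k / of_nat N) / fact k) sums
        (mat_exp (z \<cdot>\<^sub>m X) $$ (i', j') + e / of_nat N)"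
      if "X \<in> carrier_mat N N" "i' < N" "j' < N" for X N i' j'
      using sums_add[OF mat_exp_smult_sums[OF that, of z] sums_divide[OF e, of "of_nat N"]]
      by (simp add: distrib_left add_divide_distrib mult.commute[of "fact _" "of_nat N"])
    show ?thesis
      using ij h 1[OF cA, of i j] 1[OF cB, of "i - n1" "j - n1"]
      by (cases "i < n1"; cases "j < n1") simp_all
  qed
  then show "?L $$ (i, j) = ?R $$ (i, j)" using L sums_unique2 by blast
qed (use A B in \<open>auto simp: mat_exp_def complete_interconnection_def regular_mat_def\<close>)

section \<open>Encoded vectors, layout of the qubits and the joint encoding\<close>

lemma encoded_add:
  "dim_vec v = dim_vec w \<Longrightarrow> encoded enc (v + w) = (\<lambda>c. encoded enc v c + encoded enc w c)"
  by (simp add: encoded_def fun_eq_iff sum.distrib)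

lemma bits_of_permutation:
  fixes enc :: "nat \<Rightarrow> nat"
  assumes inj: "inj_on enc {..<2 ^ m}" and ran: "enc ` {..<2 ^ m} \<subseteq> {..<2 ^ m}" and c: "\<forall>l\<ge>m. \<not> c l"
  obtains j where "{j. j < 2 ^ m \<and> bit (enc j :: nat) = c} = {j}"
proof -
  obtain x :: nat where x: "x < 2 ^ m" "bit x = c" using ex_nat_bits[of m c] c by blast
  have "enc ` {..<2 ^ m} = {..<2 ^ m}"
    by (rule card_subset_eq[OF _ ran]) (simp_all add: card_image[OF inj])
  then obtain j where j: "j < 2 ^ m" "enc j = x" using x(1) by (metis imageE lessThan_iff)
  have "{j. j < 2 ^ m \<and> bit (enc j) = c} = {j}"
  proof (intro equalityI subsetI)
    fix j' assume "j' \<in> {j. j < 2 ^ m \<and> bit (enc j) = c}"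
    then have "j' < 2 ^ m" "enc j' = enc j" using j(2) x(2) injD[OF inj_bit] by auto
    then show "j' \<in> {j}" using inj_onD[OF inj] j(1) by auto
  qed (use j x in auto)
  then show ?thesis using that by blast
qed

text \<open>Each configuration of the \<open>m\<close> data qubits encodes exactly one vertex, so
  equal amplitudes on vertices are equal amplitudes on configurations, whichever permutation
  \<open>enc\<close> is.\<close>

lemma encoded_const:
  assumes "encoding (2 ^ m) m enc"
  shows "encoded enc (vec (2 ^ m) (\<lambda>_. a)) = (\<lambda>c. a * sqrt (2 ^ m) * uniform_state m c)"
proof
  fix c :: "nat \<Rightarrow> bool"
  have e: "inj_on enc {..<2 ^ m}" "enc ` {..<2 ^ m} \<subseteq> {..<2 ^ m}" using assms by (auto simp: encoding_def)
  show "encoded enc (vec (2 ^ m) (\<lambda>_. a)) c = a * sqrt (2 ^ m) * uniform_state m c"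
  proof (cases "\<forall>l\<ge>m. \<not> c l")
    case True
    then obtain j where j: "{j. j < 2 ^ m \<and> bit (enc j) = c} = {j}" using bits_of_permutation[OF e] by blast
    then have "j < 2 ^ m" by blast
    then show ?thesis using True j by (simp add: encoded_def uniform_state_def)
  next
    case False
    then obtain l where l: "m \<le> l" "c l" by blast
    have "encoded enc (vec (2 ^ m) (\<lambda>_. a)) c = 0"
      by (rule encoded_eq_0[where N = m and l = l]) (use e l in auto)
    then show ?thesis using False by (simp add: uniform_state_def)
  qed
qed

text \<open>Regrouping the sum over configurations by vertices eliminates the encoding.\<close>

lemma run_hadamards_encoded:
  assumes "encoding (2 ^ m) m enc" and "dim_vec \<psi> = 2 ^ m"
  shows "run (hadamards m) (encoded enc \<psi>) (\<lambda>_. False) = (\<Sum>j<2 ^ m. \<psi> $ j) / sqrt (2 ^ m)"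
proof -
  have W: "{w. \<forall>l\<ge>m. w l = False} = bit ` {..<2 ^ m :: nat}"
    using bit_above ex_nat_bits by (auto simp: image_iff) (metis lessThan_iff)
  have "(\<Sum>w | \<forall>l\<ge>m. w l = False. encoded enc \<psi> w) =
      (\<Sum>w\<in>bit ` {..<2 ^ m :: nat}. \<Sum>j | j \<in> {..<2 ^ m} \<and> bit (enc j) = w. \<psi> $ j)"
    unfolding W encoded_def assms(2) by simp
  also have "\<dots> = (\<Sum>j<2 ^ m. \<psi> $ j)"
    by (rule sum.group) (use assms(1) in \<open>auto simp: encoding_def\<close>)
  finally show ?thesis by (simp add: run_hadamards_at_zero)
qed

lemma supported_encoded:
  "(\<And>j. j < dim_vec \<psi> \<Longrightarrow> enc j < 2 ^ m) \<Longrightarrow> supported m (encoded enc \<psi>)"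
  unfolding supported_def using encoded_eq_0 by metis

text \<open>The qubits below \<open>M\<close> hold the data of register 2, qubit \<open>M\<close> is
  the flag, and the next \<open>M\<close> qubits hold the data of register 1. From
  \<open>2 * M + 1\<close> on the ancillas alternate by parity, so that both registers have
  unlimited supply.\<close>

definition reg1 :: "nat \<Rightarrow> nat \<Rightarrow> nat" where "reg1 M i = (if i < M then M + 1 + i else 2 * i + 2)"
definition reg2 :: "nat \<Rightarrow> nat \<Rightarrow> nat" where "reg2 M i = (if i < M then i else 2 * i + 1)"

lemma two_registers_reg: "two_registers M M (2 * M + 1) (reg1 M) (reg2 M)"
proof
  fix l
  consider "l < M" | "l = M" | "M < l" "l < 2 * M + 1" | "l \<ge> 2 * M + 1" "odd l" | "l \<ge> 2 * M + 1" "even l"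
    by linarith
  then show "l = M \<or> l \<in> range (reg1 M) \<or> l \<in> range (reg2 M)"
  proof cases
    case 1 then have "reg2 M l = l" by (simp add: reg2_def)
    then show ?thesis by (metis rangeI)
  next
    case 3 then have "reg1 M (l - M - 1) = l" by (auto simp: reg1_def)
    then show ?thesis by (metis rangeI)
  next
    case 4 then have "reg2 M (l div 2) = l" by (auto simp: reg2_def)
    then show ?thesis by (metis rangeI)
  next
    case 5 then have "reg1 M (l div 2 - 1) = l" by (auto simp: reg1_def elim!: evenE)
    then show ?thesis by (metis rangeI)
  qed simp
next
  show "reg1 M i \<noteq> reg2 M j" for i j by (simp add: reg1_def reg2_def) presburger
qed (auto simp: reg1_def reg2_def inj_def split: if_splits)

definition joint_encoding :: "nat \<Rightarrow> nat \<Rightarrow> (nat \<Rightarrow> nat) \<Rightarrow> (nat \<Rightarrow> nat) \<Rightarrow> nat \<Rightarrow> nat" where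
  "joint_encoding M n enc1 enc2 j = (if j < n then enc1 j else 2 ^ M + enc2 (j - n))"

lemma bit_add_power: "y < 2 ^ M \<Longrightarrow> bit (2 ^ M + y :: nat) l \<longleftrightarrow> l = M \<or> bit y l"
proof -
  assume "y < 2 ^ M"
  then have "2 ^ M + y = set_bit M y" using bit_above[of y M M] by (simp add: set_bit_eq)
  then show ?thesis by (auto simp: bit_set_bit_iff)
qed

text \<open>Register 1 lies entirely above the flag, so it is zero in every basis state used by the
  joint encoding, while register 2 carries the digits of \<open>y\<close>.\<close>

lemma bit_eq_config:
  fixes y :: nat
  assumes y: "y < 2 ^ M"
  shows "bit y = c \<longleftrightarrow> \<not> c M \<and> (\<forall>l. \<not> (c \<circ> reg1 M) l) \<and> bit y = c \<circ> reg2 M"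
    and "bit (2 ^ M + y) = c \<longleftrightarrow> c M \<and> (\<forall>l. \<not> (c \<circ> reg1 M) l) \<and> bit y = c \<circ> reg2 M"
proof -
  interpret two_registers M M "2 * M + 1" "reg1 M" "reg2 M" by (rule two_registers_reg)
  have M: "M \<le> reg1 M i" for i by (simp add: reg1_def)
  have b1: "\<not> bit y M" "\<not> bit y (reg1 M i)" for i
    using bit_above[OF y] M by auto
  have b2: "bit y (reg2 M i) = bit y i" for i
    using bit_above[OF y, of i] bit_above[OF y, of "2 * i + 1"] by (auto simp: reg2_def)
  show "bit y = c \<longleftrightarrow> \<not> c M \<and> (\<forall>l. \<not> (c \<circ> reg1 M) l) \<and> bit y = c \<circ> reg2 M" (is "_ \<longleftrightarrow> ?R")
  proof
    assume "bit y = c"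
    then have "c l = bit y l" for l by simp
    then show ?R using b1 b2 by (simp add: fun_eq_iff)
  next
    assume R: ?R
    then have "bit y i = c (reg2 M i)" for i by (metis o_apply)
    then show "bit y = c"
      using R b1 b2 by (intro config_eqI) (simp_all)
  qed
  show "bit (2 ^ M + y) = c \<longleftrightarrow> c M \<and> (\<forall>l. \<not> (c \<circ> reg1 M) l) \<and> bit y = c \<circ> reg2 M" (is "_ \<longleftrightarrow> ?R")
  proof
    assume "bit (2 ^ M + y) = c"
    then have "c l = bit (2 ^ M + y) l" for l by simp
    then show ?R using b1 b2 by (simp add: fun_eq_iff bit_add_power[OF y])
  next
    assume R: ?R
    then have "bit y i = c (reg2 M i)" for i by (metis o_apply)
    then show "bit (2 ^ M + y) = c"
      using R b1 b2 by (intro config_eqI) (simp_all add: bit_add_power[OF y])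
  qed
qed

lemma encoded_joint:
  assumes "dim_vec \<psi>1 = n1" and 1: "\<And>j. j < n1 \<Longrightarrow> enc1 j < 2 ^ M"
    and 2: "\<And>j. j < dim_vec \<psi>2 \<Longrightarrow> enc2 j < 2 ^ M"
  shows "encoded (joint_encoding M n1 enc1 enc2) (\<psi>1 @\<^sub>v \<psi>2) =
    two_registers.branch M (reg1 M) (reg2 M) zero_state (encoded enc1 \<psi>1) zero_state (encoded enc2 \<psi>2)"
proof
  fix c
  interpret two_registers M M "2 * M + 1" "reg1 M" "reg2 M" by (rule two_registers_reg)
  let ?z = "\<forall>l. \<not> (c \<circ> reg1 M) l"
  have *: "{j. j < n1 + dim_vec \<psi>2 \<and> bit (joint_encoding M n1 enc1 enc2 j) = c} =
      {j. j < n1 \<and> bit (enc1 j) = c} \<union> (+) n1 ` {j. j < dim_vec \<psi>2 \<and> bit (2 ^ M + enc2 j) = c}" (is "_ = ?A \<union> _ ` ?B")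
  proof (intro equalityI subsetI)
    fix j assume j: "j \<in> {j. j < n1 + dim_vec \<psi>2 \<and> bit (joint_encoding M n1 enc1 enc2 j) = c}"
    show "j \<in> ?A \<union> (+) n1 ` ?B"
    proof (cases "j < n1")
      case False
      then have "j = n1 + (j - n1)" "j - n1 \<in> ?B" using j by (auto simp: joint_encoding_def)
      then show ?thesis by blast
    qed (use j in \<open>auto simp: joint_encoding_def\<close>)
  qed (auto simp: joint_encoding_def)
  have A: "?A = (if \<not> c M \<and> ?z then {j. j < n1 \<and> bit (enc1 j) = c \<circ> reg2 M} else {})"
    using bit_eq_config(1)[OF 1, of _ c] by auto
  have B: "?B = (if c M \<and> ?z then {j. j < dim_vec \<psi>2 \<and> bit (enc2 j) = c \<circ> reg2 M} else {})"
    using bit_eq_config(2)[OF 2, of _ c] by auto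
  have "encoded (joint_encoding M n1 enc1 enc2) (\<psi>1 @\<^sub>v \<psi>2) c =
      (\<Sum>j\<in>?A. (\<psi>1 @\<^sub>v \<psi>2) $ j) + (\<Sum>j\<in>(+) n1 ` ?B. (\<psi>1 @\<^sub>v \<psi>2) $ j)"
    using assms(1) by (simp add: encoded_def * ) (subst sum.union_disjoint, auto)
  also have "(\<Sum>j\<in>?A. (\<psi>1 @\<^sub>v \<psi>2) $ j) = (\<Sum>j\<in>?A. \<psi>1 $ j)"
    using assms(1) by (intro sum.cong) auto
  also have "(\<Sum>j\<in>(+) n1 ` ?B. (\<psi>1 @\<^sub>v \<psi>2) $ j) = (\<Sum>j\<in>?B. \<psi>2 $ j)"
    using assms(1) by (subst sum.reindex) (auto intro!: sum.cong)
  finally show "encoded (joint_encoding M n1 enc1 enc2) (\<psi>1 @\<^sub>v \<psi>2) c =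
      branch zero_state (encoded enc1 \<psi>1) zero_state (encoded enc2 \<psi>2) c"
    unfolding A B by (auto simp: branch_def zero_state_def encoded_def assms(1))
qed

section \<open>Efficient implementation\<close>

lemma ctqw_eq: "ctqw \<gamma> A t = mat_exp ((- \<i> * of_real (t * \<gamma>)) \<cdot>\<^sub>m A)"
proof -
  have "(- \<i> * of_real t) \<cdot>\<^sub>m (of_real \<gamma> \<cdot>\<^sub>m A) = (- \<i> * of_real (t * \<gamma>)) \<cdot>\<^sub>m A"
    by (rule eq_matI) auto
  then show ?thesis by (simp add: ctqw_def)
qed

text \<open>A matrix with equal entries sends every vector to a constant vector, so both corrections
  to the walk encode to multiples of the uniform state, which is the shape produced by the circuit.
  One block row is treated, so that exchanging the roles of the graphs gives the other.\<close>

lemma encoded_interconnection_block: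
  fixes U :: "complex mat"
  assumes enc: "encoding (2 ^ m) m enc" and U: "U \<in> carrier_mat (2 ^ m) (2 ^ m)"
    and \<psi>: "\<psi> \<in> carrier_vec (2 ^ m)" and \<phi>: "\<phi> \<in> carrier_vec (2 ^ m')"
  shows "encoded enc (mat (2 ^ m) (2 ^ m) (\<lambda>ij. U $$ ij + \<mu> * (C - 1) / of_nat (2 ^ m)) *\<^sub>v \<psi> +
      mat (2 ^ m) (2 ^ m') (\<lambda>_. \<mu> * S / (sqrt (2 ^ m) * sqrt (2 ^ m'))) *\<^sub>v \<phi>) =
    (\<lambda>c. encoded enc (U *\<^sub>v \<psi>) c + \<mu> * ((C - 1) * ((\<Sum>j<2 ^ m. \<psi> $ j) / sqrt (2 ^ m)) +
      S * ((\<Sum>j<2 ^ m'. \<phi> $ j) / sqrt (2 ^ m'))) * uniform_state m c)"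
    (is "encoded enc ?v = _")
proof -
  define x where "x = \<mu> * ((C - 1) * ((\<Sum>j<2 ^ m. \<psi> $ j) / sqrt (2 ^ m)) +
      S * ((\<Sum>j<2 ^ m'. \<phi> $ j) / sqrt (2 ^ m')))"
  have sq: "complex_of_real (sqrt (2 ^ m)) * sqrt (2 ^ m) = 2 ^ m"
    by (simp flip: of_real_mult)
  have nz: "complex_of_real (sqrt (2 ^ m)) \<noteq> 0" by simp
  have x: "x / sqrt (2 ^ m) = \<mu> * (C - 1) / 2 ^ m * (\<Sum>j<2 ^ m. \<psi> $ j) +
      \<mu> * S / (sqrt (2 ^ m) * sqrt (2 ^ m')) * (\<Sum>j<2 ^ m'. \<phi> $ j)"
    unfolding x_def sq[symmetric] using nz by (simp add: field_simps del: of_real_power)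
  have "?v = U *\<^sub>v \<psi> + vec (2 ^ m) (\<lambda>_. x / sqrt (2 ^ m))"
    using U \<psi> \<phi> unfolding x
    by (intro eq_vecI) (auto simp: scalar_prod_def distrib_right sum.distrib sum_distrib_left
        simp flip: lessThan_atLeast0)
  then show ?thesis
    using U nz by (simp add: encoded_add encoded_const[OF enc] x_def del: of_real_power)
qed

lemma implements_complete_interconnection:
  fixes d :: real
  assumes A: "regular_mat (2 ^ m1) (of_real d) A" and B: "regular_mat (2 ^ m2) (of_real d) B"
    and enc1: "encoding (2 ^ m1) m1 enc1" and enc2: "encoding (2 ^ m2) m2 enc2"
    and gs1: "implements m1 enc1 a1 gs1 (ctqw \<gamma> A t)"
    and gs2: "implements m2 enc2 a2 gs2 (ctqw \<gamma> B t)"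
    and M: "m1 \<le> M" "m2 \<le> M"
  obtains a gs where
    "implements (M + 1) (joint_encoding M (2 ^ m1) enc1 enc2) a gs (ctqw \<gamma> (complete_interconnection A B) t)"
    and "length gs = 30 * M + 13 * (m1 + m2) + 2 + length gs1 + length gs2"
proof -
  interpret two_registers M M "2 * M + 1" "reg1 M" "reg2 M" by (rule two_registers_reg)
  let ?enc = "joint_encoding M (2 ^ m1) enc1 enc2"
  define r where "r = sqrt (2 ^ m1) * sqrt (2 ^ m2)"
  define \<tau> where "\<tau> = t * \<gamma>"
  define z where "z = - \<i> * complex_of_real \<tau>"
  \<comment> \<open>\<open>C + S\<close> and \<open>C - S\<close> are the exponentials of -i
    \<open>\<tau>\<close> \<open>r\<close> and of i \<open>\<tau>\<close> \<open>r\<close>, so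
    \<open>\<mu>\<close> times them is the walk at the eigenvalues d + r and d - r.\<close>
  define C S where "C = complex_of_real (cos (\<tau> * r))" and "S = - \<i> * complex_of_real (sin (\<tau> * r))"
  define \<mu> where "\<mu> = exp (z * of_real d)"
  let ?U1 = "mat_exp (z \<cdot>\<^sub>m A)" and ?U2 = "mat_exp (z \<cdot>\<^sub>m B)"
  have cA: "A \<in> carrier_mat (2 ^ m1) (2 ^ m1)" and cB: "B \<in> carrier_mat (2 ^ m2) (2 ^ m2)"
    using A B by (auto simp: regular_mat_def)
  have U1: "?U1 \<in> carrier_mat (2 ^ m1) (2 ^ m1)" and U2: "?U2 \<in> carrier_mat (2 ^ m2) (2 ^ m2)"
    using cA cB by (auto intro: mat_exp_carrier)
  have e1: "enc1 j < 2 ^ m1" if "j < 2 ^ m1" for j using enc1 that by (auto simp: encoding_def)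
  have e2: "enc2 j < 2 ^ m2" if "j < 2 ^ m2" for j using enc2 that by (auto simp: encoding_def)
  have e1M: "enc1 j < 2 ^ M" if "j < 2 ^ m1" for j
    using e1[OF that] by (rule less_le_trans) (simp add: M)
  have e2M: "enc2 j < 2 ^ M" if "j < 2 ^ m2" for j
    using e2[OF that] by (rule less_le_trans) (simp add: M)

  have impl1: "(\<forall>g\<in>set gs1. valid_gate (m1 + a1) g) \<and>
      (\<forall>\<psi>\<in>carrier_vec (2 ^ m1). run gs1 (encoded enc1 \<psi>) = encoded enc1 (?U1 *\<^sub>v \<psi>))"
    using implements_iff_run[OF U1, of enc1 m1 a1 gs1] e1
      gs1[unfolded ctqw_eq, folded \<tau>_def, folded z_def] by blast
  have impl2: "(\<forall>g\<in>set gs2. valid_gate (m2 + a2) g) \<and>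
      (\<forall>\<psi>\<in>carrier_vec (2 ^ m2). run gs2 (encoded enc2 \<psi>) = encoded enc2 (?U2 *\<^sub>v \<psi>))"
    using implements_iff_run[OF U2, of enc2 m2 a2 gs2] e2
      gs2[unfolded ctqw_eq, folded \<tau>_def, folded z_def] by blast
  have wf: "\<forall>g\<in>set gs1. wf_gate g" "\<forall>g\<in>set gs2. wf_gate g"
    using impl1 impl2 unfolding wf_gate_def by blast+
  have run1: "run gs1 (encoded enc1 \<psi>) = encoded enc1 (?U1 *\<^sub>v \<psi>)" if "\<psi> \<in> carrier_vec (2 ^ m1)" for \<psi>
    using impl1 that by blast
  have run2: "run gs2 (encoded enc2 \<psi>) = encoded enc2 (?U2 *\<^sub>v \<psi>)" if "\<psi> \<in> carrier_vec (2 ^ m2)" for \<psi>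
    using impl2 that by blast
  have const: "mat_exp (z \<cdot>\<^sub>m X) *\<^sub>v vec (2 ^ m) (\<lambda>_. a) = vec (2 ^ m) (\<lambda>_. \<mu> * a)"
    if "regular_mat (2 ^ m) (of_real d) X" for X m a
  proof -
    have "mat_exp (z \<cdot>\<^sub>m X) \<in> carrier_mat (2 ^ m) (2 ^ m)"
      using that by (auto intro: mat_exp_carrier simp: regular_mat_def)
    then show ?thesis
      using sum_row_mat_exp[OF that, of _ z]
      by (intro eq_vecI) (auto simp: scalar_prod_def \<mu>_def simp flip: lessThan_atLeast0 sum_distrib_right)
  qed
  \<comment> \<open>Exhibits the uniform state as an encoded vector, so that the assumption on the
    given circuits applies to it.\<close>
  have uniform: "uniform_state m = encoded enc (vec (2 ^ m) (\<lambda>_. 1 / sqrt (2 ^ m)))"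
    if "encoding (2 ^ m) m enc" for m enc
    unfolding encoded_const[OF that] by simp
  have uniform1: "run gs1 (uniform_state m1) = (\<lambda>c. \<mu> * uniform_state m1 c)"
    by (subst uniform[OF enc1], subst run1) (simp, simp only: const[OF A] encoded_const[OF enc1], simp)
  have uniform2: "run gs2 (uniform_state m2) = (\<lambda>c. \<mu> * uniform_state m2 c)"
    by (subst uniform[OF enc2], subst run2) (simp, simp only: const[OF B] encoded_const[OF enc2], simp)

  have \<mu>: "cnj \<mu> * \<mu> = 1"
  proof -
    have "\<mu> = cis (- (\<tau> * d))" by (simp add: \<mu>_def z_def cis_conv_exp mult_ac)
    then show ?thesis by (simp add: cis_cnj cis_mult)
  qed
  have CS: "unitary_mat 2 (mat2 C S S C)"
    using sin_cos_squared_add2[of "\<tau> * r", unfolded power2_eq_square]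
    by (auto simp: unitary_mat2_iff C_def S_def complex_eq_iff)
  have r0: "complex_of_real r \<noteq> 0" by (simp add: r_def)
  have r2: "complex_of_real r * complex_of_real r = of_nat (2 ^ m1) * of_nat (2 ^ m2)"
    by (simp add: r_def mult_ac flip: of_real_mult) (simp flip: mult.assoc)
  have exp_plus: "exp (z * (of_real d + of_real r)) = \<mu> * (C + S)"
    and exp_minus: "exp (z * (of_real d - of_real r)) = \<mu> * (C - S)"
  proof -
    have cs: "C + S = cis (- (\<tau> * r))" "C - S = cis (\<tau> * r)"
      by (simp_all add: C_def S_def complex_eq_iff)
    show "exp (z * (of_real d + of_real r)) = \<mu> * (C + S)"
      by (simp add: cs \<mu>_def z_def cis_conv_exp distrib_left mult_ac flip: exp_add)
    show "exp (z * (of_real d - of_real r)) = \<mu> * (C - S)"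
      by (simp add: cs \<mu>_def z_def cis_conv_exp right_diff_distrib mult_ac flip: exp_add)
  qed
  let ?P = "mat (2 ^ m1) (2 ^ m1) (\<lambda>ij. ?U1 $$ ij + \<mu> * (C - 1) / of_nat (2 ^ m1))"
    and ?Q = "mat (2 ^ m1) (2 ^ m2) (\<lambda>_. \<mu> * S / (sqrt (2 ^ m1) * sqrt (2 ^ m2)))"
    and ?R = "mat (2 ^ m2) (2 ^ m1) (\<lambda>_. \<mu> * S / (sqrt (2 ^ m2) * sqrt (2 ^ m1)))"
    and ?T = "mat (2 ^ m2) (2 ^ m2) (\<lambda>ij. ?U2 $$ ij + \<mu> * (C - 1) / of_nat (2 ^ m2))"
  let ?V = "ctqw \<gamma> (complete_interconnection A B) t"
  have eh: "(\<mu> * (C + S) + \<mu> * (C - S)) / 2 - \<mu> = \<mu> * (C - 1)"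
      "(\<mu> * (C + S) - \<mu> * (C - S)) / (2 * complex_of_real r) = \<mu> * S / r"
    by (simp_all add: field_simps)
  have V: "?V = four_block_mat ?P ?Q ?R ?T"
    using mat_exp_complete_interconnection[OF A B _ _ r2, where z = z,
        unfolded exp_plus exp_minus \<mu>_def[symmetric] eh]
    unfolding ctqw_eq \<tau>_def[symmetric] z_def[symmetric] by (simp add: r_def mult.commute)
  have cV: "?V \<in> carrier_mat (2 ^ m1 + 2 ^ m2) (2 ^ m1 + 2 ^ m2)"
    unfolding V by simp

  define gs where "gs = walk_circuit (mat2 C S S C) (cnj \<mu>) m1 m2 gs1 gs2"
  have run: "run gs (encoded ?enc \<psi>) = encoded ?enc (?V *\<^sub>v \<psi>)"
    if "\<psi> \<in> carrier_vec (2 ^ m1 + 2 ^ m2)" for \<psi>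
  proof -
    define \<psi>1 where "\<psi>1 = vec_first \<psi> (2 ^ m1)"
    define \<psi>2 where "\<psi>2 = vec_last \<psi> (2 ^ m2)"
    have c: "\<psi>1 \<in> carrier_vec (2 ^ m1)" "\<psi>2 \<in> carrier_vec (2 ^ m2)"
      by (simp_all add: \<psi>1_def \<psi>2_def)
    have \<psi>: "\<psi> = \<psi>1 @\<^sub>v \<psi>2" using that by (simp add: \<psi>1_def \<psi>2_def)
    have V\<psi>: "?V *\<^sub>v \<psi> = (?P *\<^sub>v \<psi>1 + ?Q *\<^sub>v \<psi>2) @\<^sub>v (?R *\<^sub>v \<psi>1 + ?T *\<^sub>v \<psi>2)"
      unfolding V \<psi> by (rule four_block_mat_mult_vec) (use c in auto)
    \<comment> \<open>Puts the diagonal block first, so that the same block lemma covers the second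
      row.\<close>
    have comm: "?R *\<^sub>v \<psi>1 + ?T *\<^sub>v \<psi>2 = ?T *\<^sub>v \<psi>2 + ?R *\<^sub>v \<psi>1"
      by (rule comm_add_vec[of _ "2 ^ m2"]; rule mult_mat_vec_carrier[OF mat_carrier]; rule c)
    have s: "supported m1 (encoded enc1 \<psi>1)" "supported m1 (encoded enc1 (?U1 *\<^sub>v \<psi>1))"
      "supported m2 (encoded enc2 \<psi>2)" "supported m2 (encoded enc2 (?U2 *\<^sub>v \<psi>2))"
      using c U1 U2 by (auto intro!: supported_encoded e1 e2)
    have "run gs (encoded ?enc \<psi>) = run gs (branch zero_state (encoded enc1 \<psi>1) zero_state (encoded enc2 \<psi>2))"
      unfolding \<psi> using c e1M e2M by (subst encoded_joint) auto
    also have "\<dots> = branch zero_state (encoded enc1 (?P *\<^sub>v \<psi>1 + ?Q *\<^sub>v \<psi>2))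
        zero_state (encoded enc2 (?R *\<^sub>v \<psi>1 + ?T *\<^sub>v \<psi>2))"
      unfolding gs_def comm encoded_interconnection_block[OF enc1 U1 c]
        encoded_interconnection_block[OF enc2 U2 c(2,1)]
      using run_walk_circuit[of m1 "encoded enc1 \<psi>1" gs1 m2 "encoded enc2 \<psi>2" gs2 \<mu> "cnj \<mu>" C S]
        s M uniform1 uniform2 \<mu> c
      by (simp add: run1 run2 run_hadamards_encoded[OF enc1] run_hadamards_encoded[OF enc2] del: of_real_power)
    also have "\<dots> = encoded ?enc (?V *\<^sub>v \<psi>)"
      unfolding V\<psi> using e1M e2M by (subst encoded_joint) auto
    finally show ?thesis .
  qed
  have "\<forall>g\<in>set gs. wf_gate g"
    unfolding gs_def by (rule wf_walk_circuit[OF M CS _ wf]) (use \<mu> in \<open>simp add: mult.commute\<close>)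
  then obtain a where "\<forall>g\<in>set gs. valid_gate (M + 1 + a) g" using wf_gates_bound by blast
  moreover have "?enc j < 2 ^ (M + 1)" if "j < 2 ^ m1 + 2 ^ m2" for j
    using that e1M[of j] e2M[of "j - 2 ^ m1"] by (auto simp: joint_encoding_def)
  ultimately have "implements (M + 1) ?enc a gs ?V"
    using run by (subst implements_iff_run[OF cV]) auto
  then show thesis
    by (rule that) (unfold gs_def, rule length_walk_circuit)
qed

section \<open>Polynomial bounds and register sizes for the whole family\<close>

lemma poly_mono_bound:
  fixes p :: "real poly"
  shows "\<exists>p'. \<forall>x y. 0 \<le> x \<longrightarrow> x \<le> y \<longrightarrow> poly p x \<le> poly p' y \<and> 0 \<le> poly p' y"
proof (induction p)
  case 0
  show ?case by (rule exI[of _ 0]) simp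
next
  case (pCons a p)
  then obtain p' where p': "\<And>x y. 0 \<le> x \<Longrightarrow> x \<le> y \<Longrightarrow> poly p x \<le> poly p' y \<and> 0 \<le> poly p' y" by blast
  \<comment> \<open>Replacing coefficients by their absolute values gives a monotone bound.
    Nonnegativity of \<open>poly p' y\<close> is carried along because raising the outer factor from
    \<open>x\<close> to \<open>y\<close> requires it.\<close>
  have "a + x * poly p x \<le> \<bar>a\<bar> + y * poly p' y \<and> 0 \<le> \<bar>a\<bar> + y * poly p' y" if "0 \<le> x" "x \<le> y" for x y
  proof -
    have "x * poly p x \<le> x * poly p' y" using p'[OF that] that by (simp add: mult_left_mono)
    also have "\<dots> \<le> y * poly p' y" using p'[OF that] that by (simp add: mult_right_mono)
    finally show ?thesis using p'[OF that] that by (simp add: add_mono)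
  qed
  then show ?case by (intro exI[of _ "pCons \<bar>a\<bar> p'"]) simp
qed

text \<open>The sum lies strictly above the larger power and at most at its double. Whenever the
  total number of vertices is a power of two, the register size demanded of an encoding is thus the
  \<open>M + 1\<close> qubits of the joint encoding.\<close>

lemma sum_of_powers_of_2_eq_power:
  assumes "(2::nat) ^ a + 2 ^ b = 2 ^ m"
  shows "m = max a b + 1"
proof (rule ccontr)
  assume neq: "m \<noteq> max a b + 1"
  have "(2::nat) ^ max a b < 2 ^ a + 2 ^ b" "(2::nat) ^ a + 2 ^ b \<le> 2 ^ (max a b + 1)"
    using power_increasing[of a "max a b" "2::nat"] power_increasing[of b "max a b" "2::nat"]
    by (auto simp: max_def)
  then have "max a b < m" "m \<le> max a b + 1"
    unfolding assms by (simp_all only: power_strict_increasing_iff power_increasing_iff one_less_numeral_iff semiring_norm)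
  then show False using neq by linarith
qed

lemma encoding_joint_encoding:
  assumes enc1: "encoding (2 ^ m1) m1 enc1" and enc2: "encoding (2 ^ m2) m2 enc2" and M: "M = max m1 m2"
  shows "encoding (2 ^ m1 + 2 ^ m2) (M + 1) (joint_encoding M (2 ^ m1) enc1 enc2)"
proof -
  let ?e = "joint_encoding M (2 ^ m1) enc1 enc2"
  have e1: "enc1 j < 2 ^ M" if "j < 2 ^ m1" for j
  proof -
    have "enc1 j < 2 ^ m1" using enc1 that by (auto simp: encoding_def)
    also have "\<dots> \<le> 2 ^ M" by (simp add: M)
    finally show ?thesis .
  qed
  have e2: "enc2 j < 2 ^ M" if "j < 2 ^ m2" for j
  proof -
    have "enc2 j < 2 ^ m2" using enc2 that by (auto simp: encoding_def)
    also have "\<dots> \<le> 2 ^ M" by (simp add: M)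
    finally show ?thesis .
  qed
  have "inj_on ?e {..<2 ^ m1 + 2 ^ m2}"
  proof (rule inj_onI)
    fix i j assume ij: "i \<in> {..<2 ^ m1 + 2 ^ m2}" "j \<in> {..<2 ^ m1 + 2 ^ m2}" and eq: "?e i = ?e j"
    show "i = j"
    proof (cases "i < 2 ^ m1"; cases "j < 2 ^ m1")
      assume "i < 2 ^ m1" "j < 2 ^ m1"
      then show ?thesis using eq enc1 by (auto simp: joint_encoding_def encoding_def dest: inj_onD)
    next
      assume n: "\<not> i < 2 ^ m1" "\<not> j < 2 ^ m1"
      then have "enc2 (i - 2 ^ m1) = enc2 (j - 2 ^ m1)" using eq by (simp add: joint_encoding_def)
      moreover have "inj_on enc2 {..<2 ^ m2}" "i - 2 ^ m1 \<in> {..<2 ^ m2}" "j - 2 ^ m1 \<in> {..<2 ^ m2}"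
        using enc2 ij n by (auto simp: encoding_def)
      ultimately have "i - 2 ^ m1 = j - 2 ^ m1" by (meson inj_onD)
      then show ?thesis using n by linarith
    qed (use eq e1[of i] e1[of j] in \<open>auto simp: joint_encoding_def\<close>)
  qed
  moreover have "?e j < 2 ^ (M + 1)" if "j < 2 ^ m1 + 2 ^ m2" for j
    using that e1[of j] e2[of "j - 2 ^ m1"] by (auto simp: joint_encoding_def)
  ultimately show ?thesis
    unfolding encoding_def M using sum_of_powers_of_2_eq_power by blast
qed

theorem mainTheorem3:
  fixes \<gamma> :: real
    and m\<^sub>1 m\<^sub>2 d :: "'k \<Rightarrow> nat"
    and E\<^sub>1 E\<^sub>2 :: "'k \<Rightarrow> nat set set"
  assumes "\<And>k. undirected_graph (2 ^ m\<^sub>1 k) (E\<^sub>1 k)"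
    and "\<And>k. undirected_graph (2 ^ m\<^sub>2 k) (E\<^sub>2 k)"
    and "\<And>k. degree_regular (2 ^ m\<^sub>1 k) (E\<^sub>1 k) (d k)"
    and "\<And>k. degree_regular (2 ^ m\<^sub>2 k) (E\<^sub>2 k) (d k)"
    and "efficiently_implementable_ctqws \<gamma> (\<lambda>k. adjacency_mat (2 ^ m\<^sub>1 k) (E\<^sub>1 k))"
    and "efficiently_implementable_ctqws \<gamma> (\<lambda>k. adjacency_mat (2 ^ m\<^sub>2 k) (E\<^sub>2 k))"
  shows "efficiently_implementable_ctqws \<gamma>
    (\<lambda>k. complete_interconnection (adjacency_mat (2 ^ m\<^sub>1 k) (E\<^sub>1 k))
                                  (adjacency_mat (2 ^ m\<^sub>2 k) (E\<^sub>2 k)))"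
proof -
  let ?A = "\<lambda>k. adjacency_mat (2 ^ m\<^sub>1 k) (E\<^sub>1 k)" and ?B = "\<lambda>k. adjacency_mat (2 ^ m\<^sub>2 k) (E\<^sub>2 k)"
  have dim: "dim_row (adjacency_mat n E) = n" for n E by (simp add: adjacency_mat_def)
  obtain q1 enc1 p1 where enc1: "\<And>k. encoding (2 ^ m\<^sub>1 k) (q1 k) (enc1 k)"
    and gs1: "\<And>k t. t \<ge> 0 \<Longrightarrow> \<exists>a gs. implements (q1 k) (enc1 k) a gs (ctqw \<gamma> (?A k) t) \<and>
      real (length gs) \<le> poly p1 (log 2 (real (2 ^ m\<^sub>1 k)))"
    using assms(5) unfolding efficiently_implementable_ctqws_def dim by auto
  obtain q2 enc2 p2 where enc2: "\<And>k. encoding (2 ^ m\<^sub>2 k) (q2 k) (enc2 k)"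
    and gs2: "\<And>k t. t \<ge> 0 \<Longrightarrow> \<exists>a gs. implements (q2 k) (enc2 k) a gs (ctqw \<gamma> (?B k) t) \<and>
      real (length gs) \<le> poly p2 (log 2 (real (2 ^ m\<^sub>2 k)))"
    using assms(6) unfolding efficiently_implementable_ctqws_def dim by auto
  \<comment> \<open>For a power of two the encoding condition prescribes the number of data
    qubits.\<close>
  have q: "q1 k = m\<^sub>1 k" "q2 k = m\<^sub>2 k" for k
    using enc1[of k] enc2[of k] by (auto simp: encoding_def)
  note enc = enc1[unfolded q] enc2[unfolded q]
  \<comment> \<open>A given bound may decrease between the logarithm of one graph size and the
    larger logarithm of the total size, so it is replaced by one that can be compared across the
    two.\<close>
  obtain p1' where p1': "\<And>x y. 0 \<le> x \<Longrightarrow> x \<le> y \<Longrightarrow> poly p1 x \<le> poly p1' y" using poly_mono_bound by metis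
  obtain p2' where p2': "\<And>x y. 0 \<le> x \<Longrightarrow> x \<le> y \<Longrightarrow> poly p2 x \<le> poly p2' y" using poly_mono_bound by metis
  define M where "M k = max (m\<^sub>1 k) (m\<^sub>2 k)" for k
  \<comment> \<open>56 = 30 + 13 + 13, as \<open>M k\<close>, \<open>m\<^sub>1 k\<close> and
    \<open>m\<^sub>2 k\<close> are each at most the logarithm of the total number of
    vertices.\<close>
  define p where "p = [:2, 56:] + p1' + p2'"
  have dims: "dim_row (complete_interconnection (?A k) (?B k)) = 2 ^ m\<^sub>1 k + 2 ^ m\<^sub>2 k" for k
    by (simp add: complete_interconnection_def dim)
  have main: "\<exists>a gs. implements (M k + 1) (joint_encoding (M k) (2 ^ m\<^sub>1 k) (enc1 k) (enc2 k)) a gs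
        (ctqw \<gamma> (complete_interconnection (?A k) (?B k)) t) \<and>
      real (length gs) \<le> poly p (log 2 (real (2 ^ m\<^sub>1 k + 2 ^ m\<^sub>2 k)))" if t: "t \<ge> 0" for k t
  proof -
    obtain a1 gs1 where 1: "implements (m\<^sub>1 k) (enc1 k) a1 gs1 (ctqw \<gamma> (?A k) t)"
        "real (length gs1) \<le> poly p1 (m\<^sub>1 k)"
      using gs1[OF t, of k] by (auto simp: q log_nat_power)
    obtain a2 gs2 where 2: "implements (m\<^sub>2 k) (enc2 k) a2 gs2 (ctqw \<gamma> (?B k) t)"
        "real (length gs2) \<le> poly p2 (m\<^sub>2 k)"
      using gs2[OF t, of k] by (auto simp: q log_nat_power)
    have A: "regular_mat (2 ^ m\<^sub>1 k) (of_real (real (d k))) (?A k)"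
      and B: "regular_mat (2 ^ m\<^sub>2 k) (of_real (real (d k))) (?B k)"
      using regular_mat_adjacency_mat[OF assms(1,3)] regular_mat_adjacency_mat[OF assms(2,4)] by simp_all
    have M: "m\<^sub>1 k \<le> M k" "m\<^sub>2 k \<le> M k" by (simp_all add: M_def)
    obtain a gs where gs: "implements (M k + 1) (joint_encoding (M k) (2 ^ m\<^sub>1 k) (enc1 k) (enc2 k)) a gs
        (ctqw \<gamma> (complete_interconnection (?A k) (?B k)) t)"
      and len: "length gs = 30 * M k + 13 * (m\<^sub>1 k + m\<^sub>2 k) + 2 + length gs1 + length gs2"
      using implements_complete_interconnection[OF A B enc(1) enc(2) 1(1) 2(1) M] by blast
    define L where "L = log 2 (real (2 ^ m\<^sub>1 k + 2 ^ m\<^sub>2 k))"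
    have "log 2 (2 ^ m\<^sub>1 k) \<le> L" "log 2 (2 ^ m\<^sub>2 k) \<le> L"
      unfolding L_def by (subst log_le_cancel_iff; simp add: add_pos_pos)+
    then have L: "real (m\<^sub>1 k) \<le> L" "real (m\<^sub>2 k) \<le> L"
      by (simp_all add: log_nat_power)
    then have "real (M k) \<le> L" by (simp add: M_def max_def)
    moreover have "real (length gs1) \<le> poly p1' L" "real (length gs2) \<le> poly p2' L"
      using 1(2) 2(2) p1'[OF _ L(1)] p2'[OF _ L(2)] by fastforce+
    ultimately have "real (length gs) \<le> poly p L"
      using L by (simp add: len p_def)
    then show ?thesis using gs L_def by blast
  qed
  show ?thesis
    unfolding efficiently_implementable_ctqws_def dims
    using encoding_joint_encoding[OF enc(1) enc(2) M_def] main
    by (intro exI[of _ "\<lambda>k. M k + 1"] exI[of _ "\<lambda>k. joint_encoding (M k) (2 ^ m\<^sub>1 k) (enc1 k) (enc2 k)"] exI[of _ p])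
       blast
qed

end
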